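(* There exist one-relator groups, that is, groups of the form $\mathrm{Gp}\langle A\mid w=1\rangle$ with $A$ a finite set and $w\in (A\cup A^{-1})^*$ a single word, that have undecidable rational subset membership problem.
   Context: $\mathrm{Gp}\langle A \mid R\rangle$ denotes the group defined by generators $A$ and defining relations $R$. For a set $Y$, $Y^*$ denotes the free monoid on $Y$. Let $G$ be a group with a finite group generating set $X$ and let $\pi : (X\cup X^{-1})^*\to G$ be the canonical monoid homomorphism. The rational subset membership problem for $G$ is the decision problem: the input is a finite automaton $\mathcal{A}$ over the alphabet $X\cup X^{-1}$ and a word $w\in (X\cup X^{-1})^*$; the question is whether $\pi(w)\in\pi(L(\mathcal{A}))$, where $L(\mathcal{A})$ is the language recognised by $\mathcal{A}$. It is undecidable if no algorithm solves it. *)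

theory Defs
  imports "HOL-Algebra.Generated_Groups" "HOL-Library.Nat_Bijection"
begin

section \<open>Groups given by generators and defining relations\<close>

text \<open>
  The alphabet \<open>A \<union> A\<^sup>-\<^sup>1\<close> is the disjoint sum \<open>A <+> A\<close>: the letter \<open>Inl a\<close> stands
  for the generator \<open>a\<close> and \<open>Inr a\<close> for its formal inverse.
\<close>

type_synonym 'a word = "('a + 'a) list"

definition words :: "'a set \<Rightarrow> 'a word set" where
  "words A = lists (A <+> A)"

fun inv_letter :: "'a + 'a \<Rightarrow> 'a + 'a" where
  "inv_letter (Inl a) = Inr a"
| "inv_letter (Inr a) = Inl a"

inductive pres_eq :: "'a set \<Rightarrow> ('a word \<times> 'a word) set \<Rightarrow> 'a word \<Rightarrow> 'a word \<Rightarrow> bool"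
  for A R where
  refl: "u \<in> words A \<Longrightarrow> pres_eq A R u u"
| sym: "pres_eq A R u v \<Longrightarrow> pres_eq A R v u"
| trans: "pres_eq A R u v \<Longrightarrow> pres_eq A R v x \<Longrightarrow> pres_eq A R u x"
| cancel: "u \<in> words A \<Longrightarrow> v \<in> words A \<Longrightarrow> l \<in> A <+> A
    \<Longrightarrow> pres_eq A R (u @ [l, inv_letter l] @ v) (u @ v)"
| relation: "u \<in> words A \<Longrightarrow> v \<in> words A \<Longrightarrow> (r, s) \<in> R
    \<Longrightarrow> pres_eq A R (u @ r @ v) (u @ s @ v)"

definition pres_rel :: "'a set \<Rightarrow> ('a word \<times> 'a word) set \<Rightarrow> ('a word \<times> 'a word) set" where
  "pres_rel A R = {(u, v). pres_eq A R u v}"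

text \<open>The group \<open>Gp\<langle>A | R\<rangle>\<close>; a pair \<open>(r, s) \<in> R\<close> is the defining relation \<open>r = s\<close>.\<close>

definition presented_group :: "'a set \<Rightarrow> ('a word \<times> 'a word) set \<Rightarrow> 'a word set monoid" where
  "presented_group A R =
    \<lparr>carrier = words A // pres_rel A R,
     mult = (\<lambda>U V. \<Union>u\<in>U. \<Union>v\<in>V. pres_rel A R `` {u @ v}),
     one = pres_rel A R `` {[]}\<rparr>"

definition pres_gen :: "'a set \<Rightarrow> ('a word \<times> 'a word) set \<Rightarrow> 'a \<Rightarrow> 'a word set" where
  "pres_gen A R a = pres_rel A R `` {[Inl a]}"

lemma words_simps [simp]:
  "[] \<in> words A"
  "l # u \<in> words A \<longleftrightarrow> l \<in> A <+> A \<and> u \<in> words A"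
  "u @ v \<in> words A \<longleftrightarrow> u \<in> words A \<and> v \<in> words A"
  by (auto simp: words_def)

lemma inv_letter_simps [simp]:
  "inv_letter l \<in> A <+> A \<longleftrightarrow> l \<in> A <+> A"
  "inv_letter (inv_letter l) = l"
  by (cases l; auto)+

lemma pres_eq_words:
  assumes "R \<subseteq> words A \<times> words A" "pres_eq A R u v"
  shows "u \<in> words A \<and> v \<in> words A"
  using assms(2,1) by (induction rule: pres_eq.induct) auto

lemma equiv_pres_rel:
  assumes "R \<subseteq> words A \<times> words A"
  shows "equiv (words A) (pres_rel A R)"
proof (rule equivI)
  show "pres_rel A R \<subseteq> words A \<times> words A"
    using pres_eq_words[OF assms] by (auto simp: pres_rel_def)
  show "refl_on (words A) (pres_rel A R)"
    by (auto simp: pres_rel_def refl_on_def intro: pres_eq.refl)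
  show "Relation.sym (pres_rel A R)"
    by (rule symI) (simp add: pres_rel_def pres_eq.sym)
  show "Relation.trans (pres_rel A R)"
    by (rule transI) (auto simp: pres_rel_def elim: pres_eq.trans)
qed

lemma pres_eq_context:
  assumes "pres_eq A R u v" "x \<in> words A" "y \<in> words A"
  shows "pres_eq A R (x @ u @ y) (x @ v @ y)"
  using assms
proof (induction rule: pres_eq.induct)
  case (cancel u v l)
  then show ?case using pres_eq.cancel[of "x @ u" A "v @ y" l R] by simp
next
  case (relation u v r s)
  then show ?case using pres_eq.relation[of "x @ u" A "v @ y" r s R] by simp
next
  case (refl u)
  then show ?case by (simp add: pres_eq.refl)
next
  case (sym u v)
  then show ?case by (simp add: pres_eq.sym)
next
  case (trans u v z)
  then show ?case by (meson pres_eq.trans)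
qed

lemma pres_eq_append:
  assumes R: "R \<subseteq> words A \<times> words A" and "pres_eq A R u u'" "pres_eq A R v v'"
  shows "pres_eq A R (u @ v) (u' @ v')"
proof -
  have "pres_eq A R (u @ v) (u' @ v)"
    using pres_eq_context[of A R u u' "[]" v] assms pres_eq_words[OF R] by force
  moreover have "pres_eq A R (u' @ v) (u' @ v')"
    using pres_eq_context[of A R v v' u' "[]"] assms pres_eq_words[OF R] by force
  ultimately show ?thesis by (rule pres_eq.trans)
qed

lemma presented_group_mult:
  assumes R: "R \<subseteq> words A \<times> words A" and "u \<in> words A" "v \<in> words A"
  shows "pres_rel A R `` {u} \<otimes>\<^bsub>presented_group A R\<^esub> pres_rel A R `` {v}
    = pres_rel A R `` {u @ v}"
proof -
  note e = equiv_pres_rel[OF R]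
  have "pres_rel A R `` {u' @ v'} = pres_rel A R `` {u @ v}"
    if "u' \<in> pres_rel A R `` {u}" "v' \<in> pres_rel A R `` {v}" for u' v'
    using that pres_eq_append[OF R, of u u' v v']
    by (intro equiv_class_eq[OF e, symmetric]) (simp add: pres_rel_def)
  moreover have "u \<in> pres_rel A R `` {u}" "v \<in> pres_rel A R `` {v}"
    using assms by (auto simp: pres_rel_def intro: pres_eq.refl)
  ultimately have "(\<Union>u'\<in>pres_rel A R `` {u}. \<Union>v'\<in>pres_rel A R `` {v}. pres_rel A R `` {u' @ v'})
      = pres_rel A R `` {u @ v}"
    by blast
  then show ?thesis by (simp add: presented_group_def)
qed

lemma pres_eq_inverse:
  assumes "u \<in> words A"
  shows "pres_eq A R (rev (map inv_letter u) @ u) []"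
  using assms
proof (induction u)
  case Nil
  then show ?case by (auto intro: pres_eq.refl)
next
  case (Cons l u)
  have "rev (map inv_letter u) \<in> words A"
    using Cons.prems by (auto simp: words_def in_lists_conv_set)
  then have "pres_eq A R (rev (map inv_letter u) @ [inv_letter l, l] @ u)
      (rev (map inv_letter u) @ u)"
    using Cons.prems pres_eq.cancel[of "rev (map inv_letter u)" A u "inv_letter l" R] by simp
  then show ?case using Cons by (simp add: pres_eq.trans)
qed

lemma carrier_presented_group:
  "carrier (presented_group A R) = (\<lambda>u. pres_rel A R `` {u}) ` words A"
  by (auto simp: presented_group_def quotient_def)

lemma one_presented_group: "\<one>\<^bsub>presented_group A R\<^esub> = pres_rel A R `` {[]}"
  by (simp add: presented_group_def)

theorem group_presented_group:
  assumes R: "R \<subseteq> words A \<times> words A"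
  shows "group (presented_group A R)"
proof (rule groupI)
  fix x assume "x \<in> carrier (presented_group A R)"
  then obtain u where u: "u \<in> words A" "x = pres_rel A R `` {u}"
    by (auto simp: carrier_presented_group)
  have iu: "rev (map inv_letter u) \<in> words A"
    using u by (auto simp: words_def in_lists_conv_set)
  have "pres_rel A R `` {rev (map inv_letter u) @ u} = pres_rel A R `` {[]}"
    using pres_eq_inverse[OF u(1), of R]
    by (intro equiv_class_eq[OF equiv_pres_rel[OF R]]) (simp add: pres_rel_def)
  then show "\<exists>y\<in>carrier (presented_group A R). y \<otimes>\<^bsub>presented_group A R\<^esub> x = \<one>\<^bsub>presented_group A R\<^esub>"
    using u iu presented_group_mult[OF R iu u(1)]
    unfolding carrier_presented_group one_presented_group by (metis imageI)
next
  fix x y z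
  assume "x \<in> carrier (presented_group A R)" "y \<in> carrier (presented_group A R)"
    "z \<in> carrier (presented_group A R)"
  then obtain u v w where "u \<in> words A" "x = pres_rel A R `` {u}" "v \<in> words A"
    "y = pres_rel A R `` {v}" "w \<in> words A" "z = pres_rel A R `` {w}"
    unfolding carrier_presented_group by blast
  then show "x \<otimes>\<^bsub>presented_group A R\<^esub> y \<otimes>\<^bsub>presented_group A R\<^esub> z
      = x \<otimes>\<^bsub>presented_group A R\<^esub> (y \<otimes>\<^bsub>presented_group A R\<^esub> z)"
    by (simp add: presented_group_mult[OF R])
next
  fix x y
  assume "x \<in> carrier (presented_group A R)" "y \<in> carrier (presented_group A R)"
  then obtain u v where uv: "u \<in> words A" "x = pres_rel A R `` {u}" "v \<in> words A"
    "y = pres_rel A R `` {v}"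
    unfolding carrier_presented_group by blast
  then have "x \<otimes>\<^bsub>presented_group A R\<^esub> y = pres_rel A R `` {u @ v}"
    by (simp add: presented_group_mult[OF R])
  then show "x \<otimes>\<^bsub>presented_group A R\<^esub> y \<in> carrier (presented_group A R)"
    using uv unfolding carrier_presented_group by (metis imageI words_simps(3))
next
  show "\<one>\<^bsub>presented_group A R\<^esub> \<in> carrier (presented_group A R)"
    unfolding carrier_presented_group one_presented_group by (rule imageI) simp
next
  fix x assume "x \<in> carrier (presented_group A R)"
  then obtain u where u: "u \<in> words A" "x = pres_rel A R `` {u}"
    unfolding carrier_presented_group by blast
  show "\<one>\<^bsub>presented_group A R\<^esub> \<otimes>\<^bsub>presented_group A R\<^esub> x = x"
    using presented_group_mult[OF R, of "[]" u] u by (simp add: one_presented_group)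
qed

section \<open>Evaluation of words\<close>

text \<open>
  For a family \<open>g\<close> of elements of \<open>G\<close>, the canonical monoid homomorphism sending the
  letter \<open>Inl a\<close> to \<open>g a\<close> and \<open>Inr a\<close> to its inverse.
\<close>

fun letter_val :: "('g, 'b) monoid_scheme \<Rightarrow> ('a \<Rightarrow> 'g) \<Rightarrow> 'a + 'a \<Rightarrow> 'g" where
  "letter_val G g (Inl a) = g a"
| "letter_val G g (Inr a) = inv\<^bsub>G\<^esub> (g a)"

definition word_val :: "('g, 'b) monoid_scheme \<Rightarrow> ('a \<Rightarrow> 'g) \<Rightarrow> 'a word \<Rightarrow> 'g" where
  "word_val G g w = foldr (\<lambda>l x. letter_val G g l \<otimes>\<^bsub>G\<^esub> x) w \<one>\<^bsub>G\<^esub>"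

lemma word_val_simps [simp]:
  "word_val G g [] = \<one>\<^bsub>G\<^esub>"
  "word_val G g (l # w) = letter_val G g l \<otimes>\<^bsub>G\<^esub> word_val G g w"
  by (simp_all add: word_val_def)

lemma word_val_presented_group:
  assumes R: "R \<subseteq> words A \<times> words A" and "w \<in> words A"
  shows "word_val (presented_group A R) (pres_gen A R) w = pres_rel A R `` {w}"
  using assms(2)
proof (induction w)
  case Nil
  then show ?case by (simp add: one_presented_group)
next
  case (Cons l w)
  interpret group "presented_group A R" by (rule group_presented_group[OF R])
  have "letter_val (presented_group A R) (pres_gen A R) l = pres_rel A R `` {[l]}"
  proof (cases l)
    case (Inl a)
    then show ?thesis by (simp add: pres_gen_def)
  next
    case (Inr a)
    with Cons.prems have a: "a \<in> A" by auto
    have "pres_rel A R `` {[Inr a]} \<otimes>\<^bsub>presented_group A R\<^esub> pres_rel A R `` {[Inl a]}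
        = pres_rel A R `` {[Inr a, Inl a]}"
      using a presented_group_mult[OF R, of "[Inr a]" "[Inl a]"]
      by (simp add: InlI InrI)
    also have "\<dots> = pres_rel A R `` {[]}"
      using a pres_eq.cancel[of "[]" A "[]" "Inr a" R]
      by (intro equiv_class_eq[OF equiv_pres_rel[OF R]]) (auto simp: pres_rel_def)
    finally have "inv\<^bsub>presented_group A R\<^esub> (pres_rel A R `` {[Inl a]}) = pres_rel A R `` {[Inr a]}"
      using a
      by (intro inv_equality)
         (auto simp: one_presented_group carrier_presented_group simp del: Image_singleton_iff)
    then show ?thesis using Inr by (simp add: pres_gen_def)
  qed
  then show ?case using Cons presented_group_mult[OF R, of "[l]" w] by simp
qed

lemma presented_group_generated:
  assumes R: "R \<subseteq> words A \<times> words A"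
  shows "generate (presented_group A R) (pres_gen A R ` A) = carrier (presented_group A R)"
proof
  interpret group "presented_group A R" by (rule group_presented_group[OF R])
  have g: "pres_gen A R ` A \<subseteq> carrier (presented_group A R)"
    by (auto simp: pres_gen_def carrier_presented_group)
  show "generate (presented_group A R) (pres_gen A R ` A) \<subseteq> carrier (presented_group A R)"
    using generate_incl[OF g] .
  have l: "letter_val (presented_group A R) (pres_gen A R) l
      \<in> generate (presented_group A R) (pres_gen A R ` A)" if "l \<in> A <+> A" for l
    using that by (cases l) (auto intro: generate.incl generate.inv)
  have v: "word_val (presented_group A R) (pres_gen A R) w
      \<in> generate (presented_group A R) (pres_gen A R ` A)" if "w \<in> words A" for w
    using that
  proof (induction w)
    case (Cons l w)
    then show ?case by (simp add: generate.eng l)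
  qed (simp add: generate.one)
  have "pres_rel A R `` {w} \<in> generate (presented_group A R) (pres_gen A R ` A)"
    if "w \<in> words A" for w
    using v[OF that] unfolding word_val_presented_group[OF R that] .
  then show "carrier (presented_group A R) \<subseteq> generate (presented_group A R) (pres_gen A R ` A)"
    unfolding carrier_presented_group by (rule image_subsetI)
qed

section \<open>Finite automata\<close>

text \<open>
  Nondeterministic automata as finite data: an initial state, a list of accepting states and
  a list of transitions. The states are the natural numbers occurring in it.
\<close>

datatype 'l nfa =
  NFA (initial: nat) (accepting: "nat list") (transitions: "(nat \<times> 'l \<times> nat) list")

fun nfa_path :: "'l nfa \<Rightarrow> nat \<Rightarrow> 'l list \<Rightarrow> nat \<Rightarrow> bool" where
  "nfa_path M p [] q \<longleftrightarrow> p = q"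
| "nfa_path M p (l # w) q \<longleftrightarrow> (\<exists>p'. (p, l, p') \<in> set (transitions M) \<and> nfa_path M p' w q)"

definition nfa_lang :: "'l nfa \<Rightarrow> 'l list set" where
  "nfa_lang M = {w. \<exists>q \<in> set (accepting M). nfa_path M (initial M) w q}"

definition nfa_over :: "'l set \<Rightarrow> 'l nfa \<Rightarrow> bool" where
  "nfa_over \<Sigma> M \<longleftrightarrow> (\<forall>(p, l, q) \<in> set (transitions M). l \<in> \<Sigma>)"

section \<open>Decidability\<close>

text \<open>
  Algorithms are descriptions of partial recursive functions; \<open>rec_eval f xs y\<close> means that
  \<open>f\<close> halts on the arguments \<open>xs\<close> with value \<open>y\<close>. In \<open>PrimRec f g\<close> the recursion argument
  comes first, and \<open>g\<close> receives the predecessor, the previous value and the parameters;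
  \<open>Mu f\<close> is unbounded minimisation in the first argument.
\<close>

datatype recf = Zero | Succ | Proj nat | Comp recf "recf list" | PrimRec recf recf | Mu recf

inductive rec_eval :: "recf \<Rightarrow> nat list \<Rightarrow> nat \<Rightarrow> bool" where
  zero: "rec_eval Zero xs 0"
| succ: "rec_eval Succ [x] (Suc x)"
| proj: "i < length xs \<Longrightarrow> rec_eval (Proj i) xs (xs ! i)"
| comp: "length ys = length gs \<Longrightarrow> (\<And>i. i < length gs \<Longrightarrow> rec_eval (gs ! i) xs (ys ! i))
    \<Longrightarrow> rec_eval f ys z \<Longrightarrow> rec_eval (Comp f gs) xs z"
| primrec_0: "rec_eval f xs y \<Longrightarrow> rec_eval (PrimRec f g) (0 # xs) y"
| primrec_Suc: "rec_eval (PrimRec f g) (n # xs) y \<Longrightarrow> rec_eval g (n # y # xs) z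
    \<Longrightarrow> rec_eval (PrimRec f g) (Suc n # xs) z"
| mu: "rec_eval f (n # xs) 0 \<Longrightarrow> (\<And>m. m < n \<Longrightarrow> \<exists>y. rec_eval f (m # xs) (Suc y))
    \<Longrightarrow> rec_eval (Mu f) xs n"

inductive_cases rec_eval_elims:
  "rec_eval Zero xs z"
  "rec_eval Succ xs z"
  "rec_eval (Proj i) xs z"
  "rec_eval (Comp f gs) xs z"
  "rec_eval (PrimRec f g) (0 # xs) z"
  "rec_eval (PrimRec f g) (Suc n # xs) z"
  "rec_eval (Mu f) xs z"

lemma rec_eval_deterministic: "rec_eval f xs y \<Longrightarrow> rec_eval f xs z \<Longrightarrow> y = z"
proof (induction arbitrary: z rule: rec_eval.induct)
  case (comp ys gs xs f y)
  from comp.prems obtain ys' where ys': "length ys' = length gs"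
    "\<And>i. i < length gs \<Longrightarrow> rec_eval (gs ! i) xs (ys' ! i)" "rec_eval f ys' z"
    by (elim rec_eval_elims) blast
  have "ys = ys'" using comp.hyps comp.IH(1) ys'(1,2) by (intro nth_equalityI) auto
  then show ?case using comp.IH(2) ys'(3) by simp
next
  case (primrec_Suc f g n xs y v)
  from primrec_Suc.prems obtain y' where y': "rec_eval (PrimRec f g) (n # xs) y'"
    "rec_eval g (n # y' # xs) z"
    by (elim rec_eval_elims) blast
  with primrec_Suc.IH show ?case by blast
next
  case (mu f n xs)
  from mu.prems have "rec_eval f (z # xs) 0 \<and> (\<forall>m<z. \<exists>y. rec_eval f (m # xs) (Suc y))"
    by (elim rec_eval_elims) blast
  then have z: "rec_eval f (z # xs) 0"
    "\<And>m. m < z \<Longrightarrow> \<exists>y. rec_eval f (m # xs) (Suc y)"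
    by simp_all
  have "\<not> z < n" using mu.IH(2) z(1) by blast
  moreover have "\<not> n < z" using mu.IH(1) z(2) by blast
  ultimately show ?case by simp
qed (elim rec_eval_elims; simp)+

definition decidable :: "nat set \<Rightarrow> bool" where
  "decidable S \<longleftrightarrow> (\<exists>f. \<forall>n. rec_eval f [n] (if n \<in> S then 1 else 0))"

section \<open>The rational subset membership problem\<close>

type_synonym rsm_instance = "(nat + nat) nfa \<times> nat word"

definition encode_word :: "nat word \<Rightarrow> nat" where
  "encode_word w = list_encode (map sum_encode w)"

definition encode_transition :: "nat \<times> (nat + nat) \<times> nat \<Rightarrow> nat" where
  "encode_transition = (\<lambda>(p, l, q). prod_encode (p, prod_encode (sum_encode l, q)))"

definition encode_nfa :: "(nat + nat) nfa \<Rightarrow> nat" where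
  "encode_nfa M = prod_encode (initial M, prod_encode (list_encode (accepting M),
     list_encode (map encode_transition (transitions M))))"

definition encode_instance :: "rsm_instance \<Rightarrow> nat" where
  "encode_instance = (\<lambda>(M, w). prod_encode (encode_nfa M, encode_word w))"

lemma inj_encode_instance: "inj encode_instance"
proof -
  have t: "inj encode_transition"
    by (auto simp: inj_def encode_transition_def dest: injD[OF inj_sum_encode])
  have n: "M = N" if "encode_nfa M = encode_nfa N" for M N
    using that t by (cases M; cases N)
       (auto simp: encode_nfa_def list_encode_eq inj_map_eq_map)
  have w: "v = w" if "encode_word v = encode_word w" for v w
    using that by (auto simp: encode_word_def list_encode_eq inj_map_eq_map inj_sum_encode)
  show ?thesis
    using n w by (auto simp: inj_def encode_instance_def)
qed

text \<open>
  The set of positive instances for the group \<open>G\<close> with the generating family \<open>g a\<close>,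
  \<open>a \<in> X\<close>. Whether an automaton and a word are over the finite alphabet \<open>X \<union> X\<^sup>-\<^sup>1\<close> can be
  checked effectively, so that rejecting ill-formed inputs is harmless.
\<close>

definition rational_subset_membership ::
    "('g, 'b) monoid_scheme \<Rightarrow> nat set \<Rightarrow> (nat \<Rightarrow> 'g) \<Rightarrow> rsm_instance set" where
  "rational_subset_membership G X g =
    {(M, w). nfa_over (X <+> X) M \<and> w \<in> words X \<and>
             word_val G g w \<in> word_val G g ` nfa_lang M}"

definition decidable_rational_subset_membership ::
    "('g, 'b) monoid_scheme \<Rightarrow> nat set \<Rightarrow> (nat \<Rightarrow> 'g) \<Rightarrow> bool" where
  "decidable_rational_subset_membership G X g \<longleftrightarrow>
    decidable (encode_instance ` rational_subset_membership G X g)"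

end

theory Submission
  imports Defs Complex_Main "HOL-Computational_Algebra.Primes" "HOL-Library.Infinite_Set"
begin

text \<open>
  The one-relator group is \<open>\<langle>x, t | x (t x t\<^sup>-\<^sup>1) = (t x t\<^sup>-\<^sup>1) x\<rangle>\<close>. Its elements \<open>x\<^sub>i = t\<^sup>i x t\<^sup>-\<^sup>i\<close>
  satisfy \<open>x\<^sub>i x\<^sub>i\<^sub>+\<^sub>1 = x\<^sub>i\<^sub>+\<^sub>1 x\<^sub>i\<close>. Four consecutive ones, called \<open>a, b, c, d\<close>, satisfy the relations of the
  right-angled Artin group of a path with four vertices, and this suffices to simulate register
  machines.

  The contents of all registers are kept in one number, as exponents of primes. A history
  \<open>N\<^sub>0, N\<^sub>1, ..., N\<^sub>k\<close> of such numbers is represented by two products,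
  \<open>u = (c\<^bsup>N\<^sub>0\<^esup> b\<^bsup>N\<^sub>0\<^esup> a d) (c\<^bsup>N\<^sub>1\<^esup> b\<^bsup>N\<^sub>1\<^esup> a d) ...\<close> and
  \<open>v = (a b\<^bsup>N\<^sub>0\<^esup> c\<^bsup>N\<^sub>1\<^esup> d) (a b\<^bsup>N\<^sub>1\<^esup> c\<^bsup>N\<^sub>2\<^esup> d) ...\<close>, for which the commutations give
  \<open>c\<^bsup>N\<^sub>0\<^esup> v = u c\<^bsup>N\<^sub>k\<^esup>\<close> (\<open>chain_equation\<close>). The products of the shape of \<open>u\<close> form a rational subset since
  \<open>b\<close> and \<open>c\<close> commute. For the same reason an automaton for the shape of \<open>v\<close> can
  check that the two exponents in each block are related by a step of a given program, while it
  cannot compare different blocks (\<open>program_simulated\<close>). That comparison is done by the equation: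
  conversely, if products of these shapes satisfy it, then the exponents match from block to block
  (\<open>chain_of_coordinates\<close>). For this it is enough to let the group act so that \<open>a, c\<close> generate a free
  monoid on one coordinate and \<open>b, d\<close> on another one. Solving the equation for \<open>c\<^bsup>N\<^sub>k\<^esup>\<close> gives, for
  every program, a rational subset that contains the power of \<open>c\<close> coding an input exactly if
  the program accepts this input (\<open>program_rational_subset\<close>).

  Every recursive function is computed by a program (\<open>realizable_evaluate\<close>), and every rational
  subset is the image of the language of an automaton (\<open>rational_nfa\<close>). If the membership problem were
  decidable, then so would be the question whether an automaton accepts, in this sense, the input
  made from its own code; for an automaton that accepts
  exactly when this question has a negative answer, its own code gives a contradiction (\<open>undecidable_Gamma\<close>).
\<close>

section \<open>Rational subsets of groups\<close>

locale generated_group = group G for G (structure) +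
  fixes X :: "nat set" and g :: "nat \<Rightarrow> 'a"
  assumes gen_closed: "a \<in> X \<Longrightarrow> g a \<in> carrier G"
    and X_nonempty: "X \<noteq> {}"
begin

abbreviation val :: "nat + nat \<Rightarrow> 'a" where
  "val \<equiv> letter_val G g"

lemma val_closed [simp]: "l \<in> X <+> X \<Longrightarrow> val l \<in> carrier G"
  by (cases l) (auto simp: gen_closed)

lemma val_inv: "l \<in> X <+> X \<Longrightarrow> val (inv_letter l) = inv (val l)"
  by (cases l) (auto simp: gen_closed)

lemma word_val_closed: "w \<in> words X \<Longrightarrow> word_val G g w \<in> carrier G"
  by (induction w) auto

inductive_set submonoid :: "'a set \<Rightarrow> 'a set" for S where
  one: "\<one> \<in> submonoid S"
| step: "x \<in> S \<Longrightarrow> y \<in> submonoid S \<Longrightarrow> x \<otimes> y \<in> submonoid S"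

text \<open>
  Rational subsets are generated here from single letters, so that membership can be
  established algebraically; the subset \<open>{\<one>}\<close> is the submonoid generated by \<open>{}\<close>.
\<close>
inductive rational :: "'a set \<Rightarrow> bool" where
  letter: "l \<in> X <+> X \<Longrightarrow> rational {val l}"
| empty: "rational {}"
| union: "rational S \<Longrightarrow> rational T \<Longrightarrow> rational (S \<union> T)"
| product: "rational S \<Longrightarrow> rational T \<Longrightarrow> rational (S <#> T)"
| star: "rational S \<Longrightarrow> rational (submonoid S)"

lemma submonoid_closed: "S \<subseteq> carrier G \<Longrightarrow> submonoid S \<subseteq> carrier G"
proof
  fix x assume S: "S \<subseteq> carrier G" and "x \<in> submonoid S"
  from this(2) show "x \<in> carrier G" by (induction rule: submonoid.induct) (use S in auto)
qed

lemma rational_closed: "rational S \<Longrightarrow> S \<subseteq> carrier G"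
proof (induction rule: rational.induct)
  case (product S T)
  then show ?case by (simp add: set_mult_closed)
next
  case (star S)
  show ?case by (rule submonoid_closed[OF star.IH])
qed auto

text \<open>
  Automata are first treated as finite sets of edges whose runs carry the value in \<open>G\<close> of the
  word that they read.
\<close>
inductive gpath :: "(nat \<times> (nat + nat) \<times> nat) set \<Rightarrow> nat \<Rightarrow> 'a \<Rightarrow> nat \<Rightarrow> bool" for E where
  stop: "gpath E p \<one> p"
| edge: "(p, l, q) \<in> E \<Longrightarrow> gpath E q x r \<Longrightarrow> gpath E p (val l \<otimes> x) r"

definition over :: "(nat \<times> (nat + nat) \<times> nat) set \<Rightarrow> bool" where
  "over E \<longleftrightarrow> (\<forall>(p, l, q) \<in> E. l \<in> X <+> X)"

lemma over_val: "over E \<Longrightarrow> (p, l, q) \<in> E \<Longrightarrow> val l \<in> carrier G"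
  by (intro val_closed) (fastforce simp: over_def)

lemma gpath_closed: "gpath E p x q \<Longrightarrow> over E \<Longrightarrow> x \<in> carrier G"
  by (induction rule: gpath.induct) (auto dest: over_val)

lemma gpath_mono: "gpath E p x q \<Longrightarrow> E \<subseteq> F \<Longrightarrow> gpath F p x q"
  by (induction rule: gpath.induct) (auto intro: gpath.intros)

lemma gpath_append:
  assumes "gpath E p x q" "gpath E q y r" "over E"
  shows "gpath E p (x \<otimes> y) r"
  using assms
proof (induction rule: gpath.induct)
  case (stop p)
  then show ?case using gpath_closed[OF stop.prems] by simp
next
  case (edge p l q x r')
  then have "gpath E p (val l \<otimes> (x \<otimes> y)) r" by (auto intro: gpath.edge)
  moreover have "val l \<in> carrier G" "x \<in> carrier G" "y \<in> carrier G"
    using edge.hyps edge.prems gpath_closed over_val by auto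
  ultimately show ?case by (simp add: m_assoc)
qed

lemma gpath_restrict:
  assumes "gpath F p x q" "p \<in> C"
    and "\<And>p l q. (p, l, q) \<in> F \<Longrightarrow> p \<in> C \<Longrightarrow> (p, l, q) \<in> E \<and> q \<in> C"
  shows "gpath E p x q"
  using assms by (induction rule: gpath.induct) (auto intro: gpath.intros)

text \<open>
  A building block of Thompson's construction: entry state \<open>p\<close>, exit state \<open>q\<close>, and private
  states \<open>{m..<m'}\<close>. With \<open>q\<close> outside this range no edge leaves \<open>q\<close>, so that fragments with
  disjoint private states can be glued along their exits without creating new runs.
\<close>
definition fragment :: "(nat \<times> (nat + nat) \<times> nat) set \<Rightarrow> nat \<Rightarrow> nat \<Rightarrow> nat \<Rightarrow> nat \<Rightarrow> 'a set \<Rightarrow> bool" where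
  "fragment E m m' p q S \<longleftrightarrow> finite E \<and> over E \<and> p \<in> {m..<m'}
    \<and> (\<forall>(x, l, y) \<in> E. x \<in> {m..<m'} \<and> y \<in> insert q {m..<m'})
    \<and> (\<forall>x. gpath E p x q \<longleftrightarrow> x \<in> S)"

text \<open>
  The exit of the fragment for \<open>S\<close> is the entry of the fragment for \<open>T\<close>. A run leaves the
  private states of \<open>S\<close> only through that common state and never returns, so it splits there.
\<close>
lemma fragment_product:
  assumes T: "fragment F m m1 p2 q T" and S: "fragment E m1 m2 p1 p2 S" and q: "q < m"
  shows "fragment (E \<union> F) m m2 p1 q (S <#> T)"
proof -
  have p: "p2 \<in> {m..<m1}" "p1 \<in> {m1..<m2}" and o1: "over E" "over F" "over (E \<union> F)"
    and fin: "finite E" "finite F"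
    and E: "\<And>x l y. (x, l, y) \<in> E \<Longrightarrow> x \<in> {m1..<m2} \<and> y \<in> insert p2 {m1..<m2}"
    and F: "\<And>x l y. (x, l, y) \<in> F \<Longrightarrow> x \<in> {m..<m1} \<and> y \<in> insert q {m..<m1}"
    and Sp: "\<And>x. gpath E p1 x p2 \<longleftrightarrow> x \<in> S" and Tp: "\<And>x. gpath F p2 x q \<longleftrightarrow> x \<in> T"
    using S T by (auto simp: fragment_def over_def)
  have split: "(x \<in> insert q {m..<m1} \<longrightarrow> gpath F x z q) \<and>
      (x \<in> {m1..<m2} \<longrightarrow> (\<exists>u v. gpath E x u p2 \<and> gpath F p2 v q \<and> z = u \<otimes> v))"
    if "gpath (E \<union> F) x z r" "r = q" for x z r
    using that
  proof (induction rule: gpath.induct)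
    case (stop x)
    then show ?case using q p by (auto intro: gpath.stop)
  next
    case (edge x l y r' z)
    note IH = edge.IH[OF edge.prems]
    show ?case
    proof (intro conjI impI)
      assume x: "x \<in> insert q {m..<m1}"
      then have "(x, l, y) \<notin> E" using E[of x l y] q p by auto
      with edge.hyps(1) have "(x, l, y) \<in> F" by simp
      with F IH show "gpath F x (val l \<otimes> r') q" by (blast intro: gpath.edge)
    next
      assume x: "x \<in> {m1..<m2}"
      then have "(x, l, y) \<notin> F" using F[of x l y] by auto
      with edge.hyps(1) have e: "(x, l, y) \<in> E" by simp
      then have l: "val l \<in> carrier G" using o1 over_val by blast
      from E[OF e] consider "y = p2" | "y \<in> {m1..<m2}" by auto
      then show "\<exists>u v. gpath E x u p2 \<and> gpath F p2 v q \<and> val l \<otimes> r' = u \<otimes> v"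
      proof cases
        case 1
        then have "gpath F p2 r' q" using IH p by simp
        moreover have "gpath E x (val l) p2"
          using gpath.edge[OF e gpath.stop] 1 l by simp
        ultimately show ?thesis by blast
      next
        case 2
        then obtain u v where uv: "gpath E y u p2" "gpath F p2 v q" "r' = u \<otimes> v" using IH by blast
        then have "val l \<otimes> r' = (val l \<otimes> u) \<otimes> v"
          using l gpath_closed o1 by (simp add: m_assoc)
        then show ?thesis using uv gpath.edge[OF e] by blast
      qed
    qed
  qed
  have "gpath (E \<union> F) p1 x q \<longleftrightarrow> x \<in> S <#> T" for x
  proof
    assume "gpath (E \<union> F) p1 x q"
    then obtain u v where "gpath E p1 u p2" "gpath F p2 v q" "x = u \<otimes> v"
      using split p by blast
    then show "x \<in> S <#> T" using Sp Tp by (auto simp: set_mult_def)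
  next
    assume "x \<in> S <#> T"
    then obtain u v where "u \<in> S" "v \<in> T" "x = u \<otimes> v" by (auto simp: set_mult_def)
    then show "gpath (E \<union> F) p1 x q" using Sp Tp o1(3)
      by (metis gpath_append gpath_mono sup_ge1 sup_ge2)
  qed
  then show ?thesis unfolding fragment_def using p o1 fin
    by (auto dest!: E F)
qed

text \<open>
  Automata have no silent transitions. A letter followed by its inverse takes their place: it
  costs one intermediate state and does not change the value in \<open>G\<close>.
\<close>
lemma letter_pair:
  obtains l where "l \<in> X <+> X" "inv_letter l \<in> X <+> X"
    "\<And>z. z \<in> carrier G \<Longrightarrow> val l \<otimes> (val (inv_letter l) \<otimes> z) = z"
proof -
  obtain a where "a \<in> X" using X_nonempty by blast
  then have l: "Inl a \<in> X <+> X" by blast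
  moreover have "inv_letter (Inl a) \<in> X <+> X" using l by (simp only: inv_letter_simps)
  moreover have "val (Inl a) \<otimes> (val (inv_letter (Inl a)) \<otimes> z) = z" if "z \<in> carrier G" for z
    using that l by (simp only: val_inv) (metis inv_closed l_one m_assoc r_inv val_closed)
  ultimately show ?thesis by (rule that)
qed

lemma gpath_first:
  assumes "gpath E p x q" "p \<noteq> q"
  obtains l r y where "(p, l, r) \<in> E" "gpath E r y q" "x = val l \<otimes> y"
  using assms by (cases rule: gpath.cases) auto

lemma fragment_union:
  assumes S: "fragment E m m1 p1 q S" and T: "fragment F m1 m2 p2 q T" and q: "q < m"
  shows "\<exists>D. fragment D m (m2 + 3) m2 q (S \<union> T)"
proof -
  obtain l where l: "l \<in> X <+> X" "inv_letter l \<in> X <+> X"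
    "\<And>z. z \<in> carrier G \<Longrightarrow> val l \<otimes> (val (inv_letter l) \<otimes> z) = z"
    by (rule letter_pair) (rule that; simp)
  have p: "p1 \<in> {m..<m1}" "p2 \<in> {m1..<m2}" and o1: "over E" "over F"
    and fin: "finite E" "finite F"
    and E: "\<And>x l y. (x, l, y) \<in> E \<Longrightarrow> x \<in> {m..<m1} \<and> y \<in> insert q {m..<m1}"
    and F: "\<And>x l y. (x, l, y) \<in> F \<Longrightarrow> x \<in> {m1..<m2} \<and> y \<in> insert q {m1..<m2}"
    and Sp: "\<And>x. gpath E p1 x q \<longleftrightarrow> x \<in> S" and Tp: "\<And>x. gpath F p2 x q \<longleftrightarrow> x \<in> T"
    using S T by (auto simp: fragment_def)
  define N where "N = {(m2, l, m2 + 1), (m2 + 1, inv_letter l, p1),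
    (m2, l, m2 + 2), (m2 + 2, inv_letter l, p2)}"
  let ?D = "E \<union> F \<union> N"
  have over: "over ?D" using o1 l by (auto simp: over_def N_def)
  have res1: "gpath E p1 z q" if "gpath ?D p1 z q" for z
  proof (rule gpath_restrict[OF that, of "insert q {m..<m1}"])
    fix x l' y assume "(x, l', y) \<in> ?D" "x \<in> insert q {m..<m1}"
    then show "(x, l', y) \<in> E \<and> y \<in> insert q {m..<m1}"
      using E[of x l' y] F[of x l' y] p q by (auto simp: N_def)
  qed (use p in auto)
  have res2: "gpath F p2 z q" if "gpath ?D p2 z q" for z
  proof (rule gpath_restrict[OF that, of "insert q {m1..<m2}"])
    fix x l' y assume "(x, l', y) \<in> ?D" "x \<in> insert q {m1..<m2}"
    then show "(x, l', y) \<in> F \<and> y \<in> insert q {m1..<m2}"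
      using E[of x l' y] F[of x l' y] p q by (auto simp: N_def)
  qed (use p in auto)
  have "gpath ?D m2 x q \<longleftrightarrow> x \<in> S \<union> T" for x
  proof
    assume path: "gpath ?D m2 x q"
    have m2: "m \<le> m2" using p by auto
    obtain l1 r1 y1 where 1: "(m2, l1, r1) \<in> ?D" "gpath ?D r1 y1 q" "x = val l1 \<otimes> y1"
      by (rule gpath_first[OF path]) (use q m2 in auto)
    have r1: "l1 = l" "r1 = m2 + 1 \<or> r1 = m2 + 2" using 1(1) p by (auto simp: N_def dest!: E F)
    obtain l2 r2 y2 where 2: "(r1, l2, r2) \<in> ?D" "gpath ?D r2 y2 q" "y1 = val l2 \<otimes> y2"
      by (rule gpath_first[OF 1(2)]) (use q m2 r1 in auto)
    have r2: "l2 = inv_letter l" "r2 = p1 \<or> r2 = p2" using 2(1) r1 p by (auto simp: N_def dest!: E F)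
    have "x = y2" using 1(3) 2(3) r1(1) r2(1) l(3) gpath_closed[OF 2(2) over] by simp
    then show "x \<in> S \<union> T" using 2(2) r2(2) res1 res2 Sp Tp by auto
  next
    assume x: "x \<in> S \<union> T"
    then have "gpath ?D p1 x q \<or> gpath ?D p2 x q"
      using Sp[of x] Tp[of x] gpath_mono[of E p1 x q ?D] gpath_mono[of F p2 x q ?D] by blast
    moreover have e: "(m2, l, m2 + 1) \<in> ?D" "(m2 + 1, inv_letter l, p1) \<in> ?D"
      "(m2, l, m2 + 2) \<in> ?D" "(m2 + 2, inv_letter l, p2) \<in> ?D"
      by (simp_all add: N_def)
    ultimately have "gpath ?D m2 (val l \<otimes> (val (inv_letter l) \<otimes> x)) q" "x \<in> carrier G"
      using gpath_closed[OF _ over] gpath.edge[OF e(1) gpath.edge[OF e(2)]]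
        gpath.edge[OF e(3) gpath.edge[OF e(4)]] by blast+
    then show "gpath ?D m2 x q" using l(3) by simp
  qed
  moreover have "finite ?D" using fin by (simp add: N_def)
  ultimately show ?thesis unfolding fragment_def using over p
    by (intro exI[of _ ?D]) (auto simp: N_def dest!: E F)
qed

text \<open>
  The entry \<open>m\<close> is also the exit of the fragment for \<open>S\<close>, so that every passage through that
  fragment leads back to \<open>m\<close>; the states \<open>m + 1\<close> and \<open>m + 2\<close> serve the silent moves from \<open>m\<close>
  into the fragment and out of the loop.
\<close>
lemma fragment_star:
  assumes S: "fragment E (m + 3) m1 p1 m S" and q: "q < m"
  shows "\<exists>D. fragment D m m1 m q (submonoid S)"
proof -
  obtain l where l: "l \<in> X <+> X" "inv_letter l \<in> X <+> X"
    "\<And>z. z \<in> carrier G \<Longrightarrow> val l \<otimes> (val (inv_letter l) \<otimes> z) = z"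
    by (rule letter_pair) (rule that; simp)
  have p: "p1 \<in> {m + 3..<m1}" and o1: "over E" and fin: "finite E"
    and E: "\<And>x l y. (x, l, y) \<in> E \<Longrightarrow> x \<in> {m + 3..<m1} \<and> y \<in> insert m {m + 3..<m1}"
    and Sp: "\<And>x. gpath E p1 x m \<longleftrightarrow> x \<in> S"
    using S by (auto simp: fragment_def)
  define N where "N = {(m, l, m + 1), (m + 1, inv_letter l, p1),
    (m, l, m + 2), (m + 2, inv_letter l, q)}"
  let ?D = "E \<union> N"
  have over: "over ?D" using o1 l by (auto simp: over_def N_def)
  have Sc: "S \<subseteq> carrier G" using Sp gpath_closed o1 by blast
  note Mc = submonoid_closed[OF Sc, THEN subsetD]
  \<comment> \<open>What a run from each kind of state to the exit can spell, by induction on the run.\<close>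
  have main: "(x = m \<longrightarrow> z \<in> submonoid S) \<and>
      (x \<in> {m + 1, m + 2} \<longrightarrow> val l \<otimes> z \<in> submonoid S) \<and> (x = q \<longrightarrow> z = \<one>) \<and>
      (x \<in> {m + 3..<m1} \<longrightarrow> (\<exists>u k. gpath E x u m \<and> k \<in> submonoid S \<and> z = u \<otimes> k))"
    if "gpath ?D x z r" "r = q" for x z r
    using that
  proof (induction rule: gpath.induct)
    case (stop x)
    then show ?case using q by auto
  next
    case (edge x l' y z r)
    note IH = edge.IH[OF edge.prems]
    have zc: "z \<in> carrier G" using gpath_closed[OF edge.hyps(2) over] .
    from edge.hyps(1) consider (E) "(x, l', y) \<in> E"
      | (a) "x = m" "l' = l" "y \<in> {m + 1, m + 2}"
      | (b) "x = m + 1" "l' = inv_letter l" "y = p1"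
      | (c) "x = m + 2" "l' = inv_letter l" "y = q"
      by (auto simp: N_def)
    then show ?case
    proof cases
      case E
      have x: "x \<in> {m + 3..<m1}" and y: "y = m \<or> y \<in> {m + 3..<m1}" using assms E by (auto simp: fragment_def)
      have l': "val l' \<in> carrier G" using E o1 over_val by blast
      from y have "\<exists>u k. gpath E x u m \<and> k \<in> submonoid S \<and> val l' \<otimes> z = u \<otimes> k"
      proof
        assume "y = m"
        then have "z \<in> submonoid S" using IH by simp
        moreover have "gpath E x (val l') m"
          using gpath.edge[OF E gpath.stop] \<open>y = m\<close> l' by simp
        ultimately show ?thesis by blast
      next
        assume "y \<in> {m + 3..<m1}"
        then obtain u k where uk: "gpath E y u m" "k \<in> submonoid S" "z = u \<otimes> k" using IH by blast
        then have "val l' \<otimes> z = (val l' \<otimes> u) \<otimes> k"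
          using l' gpath_closed[OF uk(1) o1] Mc by (simp add: m_assoc)
        then show ?thesis using uk gpath.edge[OF E] by blast
      qed
      then show ?thesis using x q by auto
    next
      case a
      then show ?thesis using IH q by auto
    next
      case b
      then obtain u k where "gpath E p1 u m" "k \<in> submonoid S" "z = u \<otimes> k" using IH p by blast
      then have "z \<in> submonoid S" using Sp submonoid.step by blast
      then show ?thesis using b l(3)[OF zc] q by auto
    next
      case c
      then have "z = \<one>" using IH by simp
      then show ?thesis using c l(3)[OF zc] q submonoid.one by auto
    qed
  qed
  have "gpath ?D m x q \<longleftrightarrow> x \<in> submonoid S" for x
  proof
    assume "gpath ?D m x q"
    then show "x \<in> submonoid S" using main by blast
  next
    have skip: "gpath ?D m x r" if "y \<in> {m + 1, m + 2}" "(y, inv_letter l, y') \<in> ?D" "gpath ?D y' x r" for x y y' r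
    proof -
      have "gpath ?D m (val l \<otimes> (val (inv_letter l) \<otimes> x)) r"
        using that by (intro gpath.edge[where E = ?D] that) (auto simp: N_def)
      then show ?thesis using l(3) gpath_closed[OF that(3) over] by simp
    qed
    assume "x \<in> submonoid S"
    then show "gpath ?D m x q"
    proof (induction rule: submonoid.induct)
      case one
      show ?case by (rule skip[of "m + 2" q]) (auto simp: N_def intro: gpath.stop)
    next
      case (step x y)
      have "gpath ?D p1 x m" using Sp step.hyps(1) gpath_mono by blast
      then have "gpath ?D m x m" by (rule skip[of "m + 1" p1, rotated 2]) (auto simp: N_def)
      then show ?case using step.IH over by (rule gpath_append)
    qed
  qed
  moreover have "finite ?D" using fin by (simp add: N_def)
  ultimately show ?thesis unfolding fragment_def using over p q
    by (intro exI[of _ ?D]) (auto simp: N_def dest!: E)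
qed

lemma rational_fragment:
  "rational S \<Longrightarrow> q < m \<Longrightarrow> \<exists>E m' p. fragment E m m' p q S"
proof (induction arbitrary: q m rule: rational.induct)
  case (letter l)
  let ?E = "{(m, l, q)}"
  have "gpath ?E m x q \<longleftrightarrow> x \<in> {val l}" for x
  proof
    assume "gpath ?E m x q"
    then obtain l' r y where 1: "(m, l', r) \<in> ?E" "gpath ?E r y q" "x = val l' \<otimes> y"
      by (rule gpath_first) (use letter in auto)
    then have "y = \<one>" using letter by (auto elim: gpath.cases)
    then show "x \<in> {val l}" using 1 letter by simp
  next
    assume "x \<in> {val l}"
    then show "gpath ?E m x q" using gpath.edge[of m l q ?E "\<one>" q] gpath.stop letter by simp
  qed
  then show ?case using letter
    by (intro exI[of _ ?E] exI[of _ "Suc m"] exI[of _ m]) (auto simp: fragment_def over_def)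
next
  case empty
  have "\<not> gpath {} m x q" for x using empty by (auto elim: gpath.cases)
  then show ?case
    by (intro exI[of _ "{}"] exI[of _ "Suc m"] exI[of _ m]) (auto simp: fragment_def over_def)
next
  case (union S T)
  obtain E m1 p1 where E: "fragment E m m1 p1 q S" using union by blast
  then have "q < m1" using union.prems by (auto simp: fragment_def)
  then obtain F m2 p2 where "fragment F m1 m2 p2 q T" using union by blast
  then show ?case using fragment_union[OF E _ union.prems] by blast
next
  case (product S T)
  obtain F m1 p2 where F: "fragment F m m1 p2 q T" using product by blast
  then have "p2 < m1" by (auto simp: fragment_def)
  then obtain E m2 p1 where "fragment E m1 m2 p1 p2 S" using product by blast
  then show ?case using fragment_product[OF F _ product.prems] by blast
next
  case (star S)
  have "m < m + 3" by simp
  then obtain E m1 p1 where "fragment E (m + 3) m1 p1 m S" using star.IH by blast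
  then show ?case using fragment_star star.prems by blast
qed

theorem rational_nfa:
  assumes "rational S"
  shows "\<exists>M. nfa_over (X <+> X) M \<and> word_val G g ` nfa_lang M = S"
proof -
  obtain E m p where "fragment E 1 m p 0 S" using rational_fragment[OF assms zero_less_one] by blast
  then have fin: "finite E" and E: "over E" and S: "\<And>x. gpath E p x 0 \<longleftrightarrow> x \<in> S"
    by (auto simp: fragment_def)
  obtain ts where ts: "set ts = E" using finite_list[OF fin] by blast
  let ?M = "NFA p [0] ts"
  have 1: "nfa_path ?M x w y \<Longrightarrow> gpath E x (word_val G g w) y" for x w y
    by (induction w arbitrary: x) (auto simp: ts intro: gpath.intros)
  have 2: "gpath E x z y \<Longrightarrow> \<exists>w. nfa_path ?M x w y \<and> word_val G g w = z" for x z y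
  proof (induction rule: gpath.induct)
    case (stop p)
    then show ?case by (intro exI[of _ "[]"]) simp
  next
    case (edge x l y z r)
    then obtain w where "nfa_path ?M y w r" "word_val G g w = z" by blast
    then show ?case using edge.hyps(1) ts by (intro exI[of _ "l # w"]) auto
  qed
  have "word_val G g ` nfa_lang ?M = S"
  proof (intro equalityI subsetI)
    fix x assume "x \<in> word_val G g ` nfa_lang ?M"
    then show "x \<in> S" using 1 S by (auto simp: nfa_lang_def)
  next
    fix x assume "x \<in> S"
    then obtain w where "nfa_path ?M p w 0" "word_val G g w = x" using 2 S by blast
    then show "x \<in> word_val G g ` nfa_lang ?M" by (auto simp: nfa_lang_def intro!: image_eqI[of _ _ w])
  qed
  moreover have "nfa_over (X <+> X) ?M" using E by (simp add: nfa_over_def over_def ts)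
  ultimately show ?thesis by blast
qed

lemma rational_one: "rational {\<one>}"
proof -
  have "submonoid {} = {\<one>}" by (auto elim: submonoid.cases intro: submonoid.one)
  then show ?thesis using rational.star[OF rational.empty] by simp
qed

lemma rational_mult: "rational {x} \<Longrightarrow> rational {y} \<Longrightarrow> rational {x \<otimes> y}"
  using rational.product[of "{x}" "{y}"] by (simp add: set_mult_def)

lemma rational_pow: "rational {x} \<Longrightarrow> rational {x [^] (n :: nat)}"
  by (induction n) (auto intro: rational_one rational_mult)

lemma submonoid_singleton:
  assumes "x \<in> carrier G"
  shows "submonoid {x} = range (\<lambda>n :: nat. x [^] n)"
proof (intro equalityI subsetI)
  fix y assume "y \<in> submonoid {x}"
  then show "y \<in> range (\<lambda>n :: nat. x [^] n)"
  proof (induction rule: submonoid.induct)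
    case one
    then show ?case by (intro image_eqI[of _ _ 0]) auto
  next
    case (step z y)
    then obtain n :: nat where "y = x [^] n" by blast
    then show ?case using step.hyps(1) assms
      by (intro image_eqI[of _ _ "Suc n"]) (auto simp: nat_pow_Suc2[symmetric] simp del: nat_pow_Suc)
  qed
next
  fix y assume "y \<in> range (\<lambda>n :: nat. x [^] n)"
  then obtain n :: nat where "y = x [^] n" by blast
  moreover have "x [^] n \<in> submonoid {x}"
  proof (induction n)
    case (Suc n)
    then show ?case using assms by (simp only: nat_pow_Suc2) (auto intro: submonoid.step)
  qed (simp add: submonoid.one)
  ultimately show "y \<in> submonoid {x}" by simp
qed

lemma rational_powers: "rational {x} \<Longrightarrow> rational (range (\<lambda>n :: nat. x [^] n))"
  using rational.star[of "{x}"] rational_closed[of "{x}"] by (simp add: submonoid_singleton)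

lemma rational_finite_Union:
  "finite I \<Longrightarrow> (\<And>i. i \<in> I \<Longrightarrow> rational (S i)) \<Longrightarrow> rational (\<Union>i\<in>I. S i)"
  by (induction rule: finite_induct) (auto intro: rational.empty rational.union)

end

section \<open>Register programs\<close>

type_synonym store = "nat \<Rightarrow> nat"

text \<open>
  Programs on registers that hold natural numbers, identified with their input-output relation.
  Nondeterminism is harmless, and it makes a while loop the composition of an iteration with a
  test.
\<close>
inductive program :: "(store \<times> store) set \<Rightarrow> bool" where
  increment: "program {(s, s(r := Suc (s r))) | s. True}"
| decrement: "program {(s(r := Suc (s r)), s) | s. True}"
| zero_test: "program {(s, s) | s. s r = 0}"
| seq: "program R \<Longrightarrow> program S \<Longrightarrow> program (R O S)"
| loop: "program R \<Longrightarrow> program (R\<^sup>*)"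

text \<open>
  Computations can be run backwards. This lets the input of a program appear at the end of a
  simulated computation, whose code is the one for which the equations in the group are solved.
\<close>
lemma program_converse: "program R \<Longrightarrow> program (R\<inverse>)"
proof (induction rule: program.induct)
  case (increment r)
  have "{(s, s(r := Suc (s r))) | s. True}\<inverse> = {(s(r := Suc (s r)), s) | s. True}" by auto
  then show ?case using program.decrement by simp
next
  case (decrement r)
  have "{(s(r := Suc (s r)), s) | s. True}\<inverse> = {(s, s(r := Suc (s r))) | s. True}" by auto
  then show ?case using program.increment by simp
next
  case (zero_test r)
  have "{(s, s) | s. s r = 0}\<inverse> = {(s :: store, s) | s. s r = 0}" by auto
  then show ?case using program.zero_test[of r] by simp
next
  case (seq R S)
  then show ?case by (simp add: converse_relcomp program.seq)
next
  case (loop R)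
  then show ?case by (simp add: rtrancl_converse[symmetric] program.loop)
qed

definition clean :: "nat \<Rightarrow> store set" where
  "clean b = {s. \<forall>r\<ge>b. s r = 0}"

text \<open>
  A program may use the registers from \<open>b\<close> on as scratch space, provided that it finds them
  empty. Only its behaviour on such stores is prescribed.
\<close>
definition realizable :: "nat \<Rightarrow> (store \<times> store) set \<Rightarrow> bool" where
  "realizable b Q \<longleftrightarrow> (\<exists>R. program R \<and> (\<forall>s\<in>clean b. \<forall>s'. (s, s') \<in> R \<longleftrightarrow> (s, s') \<in> Q))"

lemma realizable_program: "program R \<Longrightarrow> realizable b R"
  by (auto simp: realizable_def)

lemma realizable_mono: "realizable b Q \<Longrightarrow> b' \<le> b \<Longrightarrow> realizable b' Q"
  unfolding realizable_def clean_def by (smt (verit, best) mem_Collect_eq order_trans)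

lemma realizable_cong:
  assumes "realizable b Q" "\<And>s s'. s \<in> clean b \<Longrightarrow> (s, s') \<in> Q \<longleftrightarrow> (s, s') \<in> Q'"
  shows "realizable b Q'"
  using assms unfolding realizable_def by metis

definition preserves :: "nat \<Rightarrow> (store \<times> store) set \<Rightarrow> bool" where
  "preserves b Q \<longleftrightarrow> (\<forall>s s'. s \<in> clean b \<longrightarrow> (s, s') \<in> Q \<longrightarrow> s' \<in> clean b)"

lemma preserves_seq: "preserves b P \<Longrightarrow> preserves b Q \<Longrightarrow> preserves b (P O Q)"
  unfolding preserves_def by blast

lemma preserves_loop:
  assumes "preserves b Q"
  shows "preserves b (Q\<^sup>*)"
proof -
  have "(s, s') \<in> Q\<^sup>* \<Longrightarrow> s \<in> clean b \<Longrightarrow> s' \<in> clean b" for s s'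
    by (induction rule: rtrancl_induct) (use assms in \<open>auto simp: preserves_def\<close>)
  then show ?thesis unfolding preserves_def by blast
qed

lemma realizable_seq:
  assumes "realizable b P" "realizable b Q" and pres: "preserves b P"
  shows "realizable b (P O Q)"
proof -
  obtain R S where R: "program R" "\<forall>s\<in>clean b. \<forall>s'. (s, s') \<in> R \<longleftrightarrow> (s, s') \<in> P"
    and S: "program S" "\<forall>s\<in>clean b. \<forall>s'. (s, s') \<in> S \<longleftrightarrow> (s, s') \<in> Q"
    using assms(1,2) unfolding realizable_def by blast
  have "(s, s') \<in> R O S \<longleftrightarrow> (s, s') \<in> P O Q" if "s \<in> clean b" for s s'
    using that R(2) S(2) pres unfolding preserves_def by blast
  then show ?thesis unfolding realizable_def using program.seq[OF R(1) S(1)] by blast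
qed

lemma realizable_loop:
  assumes "realizable b Q" and "preserves b Q"
  shows "realizable b (Q\<^sup>*)"
proof -
  obtain R where R: "program R" "\<forall>s\<in>clean b. \<forall>s'. (s, s') \<in> R \<longleftrightarrow> (s, s') \<in> Q"
    using assms(1) unfolding realizable_def by blast
  note pres = assms(2)[unfolded preserves_def, rule_format]
  have "(s, s') \<in> R\<^sup>* \<longleftrightarrow> (s, s') \<in> Q\<^sup>*" if s: "s \<in> clean b" for s s'
  proof
    assume "(s, s') \<in> R\<^sup>*"
    then have "s' \<in> clean b \<and> (s, s') \<in> Q\<^sup>*"
    proof (induction rule: rtrancl_induct)
      case (step x y)
      then show ?case using R(2) pres by (meson rtrancl.rtrancl_into_rtrancl)
    qed (simp add: s)
    then show "(s, s') \<in> Q\<^sup>*" ..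
  next
    assume "(s, s') \<in> Q\<^sup>*"
    then have "s' \<in> clean b \<and> (s, s') \<in> R\<^sup>*"
    proof (induction rule: rtrancl_induct)
      case (step x y)
      then show ?case using R(2) pres by (meson rtrancl.rtrancl_into_rtrancl)
    qed (simp add: s)
    then show "(s, s') \<in> R\<^sup>*" ..
  qed
  then show ?thesis unfolding realizable_def using program.loop[OF R(1)] by blast
qed

definition inc :: "nat \<Rightarrow> (store \<times> store) set" where
  "inc r = {(s, s') | s s'. s' = s(r := Suc (s r))}"

definition dec :: "nat \<Rightarrow> (store \<times> store) set" where
  "dec r = {(s, s') | s s'. s r > 0 \<and> s' = s(r := s r - 1)}"

definition test0 :: "nat \<Rightarrow> (store \<times> store) set" where
  "test0 r = {(s, s') | s s'. s r = 0 \<and> s' = s}"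

definition clear :: "nat \<Rightarrow> (store \<times> store) set" where
  "clear r = {(s, s') | s s'. s' = s(r := 0)}"

definition drain :: "nat \<Rightarrow> nat \<Rightarrow> nat \<Rightarrow> (store \<times> store) set" where
  "drain x y z = {(s, s') | s s'. s' = s(x := 0, y := s y + s x, z := s z + s x)}"

definition assign :: "nat \<Rightarrow> nat \<Rightarrow> (store \<times> store) set" where
  "assign y x = {(s, s') | s s'. s' = s(y := s x)}"

lemma in_ops:
  "(s, s') \<in> inc r \<longleftrightarrow> s' = s(r := Suc (s r))"
  "(s, s') \<in> dec r \<longleftrightarrow> s r > 0 \<and> s' = s(r := s r - 1)"
  "(s, s') \<in> test0 r \<longleftrightarrow> s r = 0 \<and> s' = s"
  "(s, s') \<in> clear r \<longleftrightarrow> s' = s(r := 0)"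
  "(s, s') \<in> drain x y z \<longleftrightarrow> s' = s(x := 0, y := s y + s x, z := s z + s x)"
  "(s, s') \<in> assign y x \<longleftrightarrow> s' = s(y := s x)"
  by (auto simp: inc_def dec_def test0_def clear_def drain_def assign_def)

lemma in_ops_seq:
  "(s, s') \<in> inc r O Q \<longleftrightarrow> (s(r := Suc (s r)), s') \<in> Q"
  "(s, s') \<in> dec r O Q \<longleftrightarrow> s r > 0 \<and> (s(r := s r - 1), s') \<in> Q"
  "(s, s') \<in> test0 r O Q \<longleftrightarrow> s r = 0 \<and> (s, s') \<in> Q"
  "(s, s') \<in> clear r O Q \<longleftrightarrow> (s(r := 0), s') \<in> Q"
  "(s, s') \<in> drain x y z O Q \<longleftrightarrow> (s(x := 0, y := s y + s x, z := s z + s x), s') \<in> Q"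
  "(s, s') \<in> assign y x O Q \<longleftrightarrow> (s(y := s x), s') \<in> Q"
  by (auto simp: in_ops relcomp_unfold)

lemma program_inc: "program (inc r)"
  using program.increment[of r] by (simp add: inc_def)

lemma program_dec: "program (dec r)"
proof -
  have "(s, s') \<in> dec r \<longleftrightarrow> (s, s') \<in> {(s(r := Suc (s r)), s) | s. True}" for s s'
  proof
    assume "(s, s') \<in> dec r"
    then have "s = s'(r := Suc (s' r))" by (auto simp: in_ops fun_eq_iff)
    then show "(s, s') \<in> {(s(r := Suc (s r)), s) | s. True}" by blast
  qed (auto simp: in_ops)
  then have "dec r = {(s(r := Suc (s r)), s) | s. True}" by auto
  then show ?thesis using program.decrement by simp
qed

lemma program_test0: "program (test0 r)"
proof -
  have "test0 r = {(s, s) | s. s r = 0}" by (auto simp: test0_def)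
  then show ?thesis using program.zero_test by simp
qed

lemma program_clear: "program (clear r)"
proof -
  have down: "(s, s') \<in> (dec r)\<^sup>* \<Longrightarrow> \<exists>n. s' = s(r := n)" for s s'
  proof (induction rule: rtrancl_induct)
    case base
    show ?case by (rule exI[of _ "s r"]) simp
  next
    case (step u v)
    then show ?case by (metis fun_upd_upd in_ops(2))
  qed
  have up: "s r = n \<Longrightarrow> (s, s(r := 0)) \<in> (dec r)\<^sup>*" for s n
  proof (induction n arbitrary: s)
    case 0
    then have "s = s(r := 0)" by (auto simp: fun_eq_iff)
    then show ?case by (metis rtrancl.rtrancl_refl)
  next
    case (Suc n)
    have "(s, s(r := n)) \<in> dec r" using Suc.prems by (simp add: in_ops)
    moreover have "(s(r := n), s(r := 0)) \<in> (dec r)\<^sup>*" using Suc.IH[of "s(r := n)"]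
      by (simp only: fun_upd_upd fun_upd_same simp_thms)
    ultimately show ?case by (rule converse_rtrancl_into_rtrancl)
  qed
  have "(s, s') \<in> (dec r)\<^sup>* O test0 r \<longleftrightarrow> (s, s') \<in> clear r" for s s'
    using down[of s s'] up[OF HOL.refl, of s] by (force simp: in_ops)
  then have "clear r = (dec r)\<^sup>* O test0 r" by auto
  then show ?thesis using program_dec program_test0 by (simp add: program.intros)
qed

lemma program_drain:
  assumes d: "x \<noteq> y" "x \<noteq> z" "y \<noteq> z"
  shows "program (drain x y z)"
proof -
  let ?W = "dec x O inc y O inc z"
  let ?m = "\<lambda>s k. s(x := s x - k, y := s y + k, z := s z + k)"
  have W: "(s, s') \<in> ?W \<longleftrightarrow> s x > 0 \<and> s' = ?m s 1" for s s'
    using d by (simp add: in_ops_seq in_ops)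
  have down: "(s, s') \<in> ?W\<^sup>* \<Longrightarrow> \<exists>k\<le>s x. s' = ?m s k" for s s'
  proof (induction rule: rtrancl_induct)
    case base
    show ?case by (rule exI[of _ 0]) auto
  next
    case (step u v)
    then obtain k where k: "k \<le> s x" "u = ?m s k" by blast
    with step(2) have "Suc k \<le> s x" "v = ?m s (Suc k)"
      using d by (auto simp: W fun_eq_iff)
    then show ?case by blast
  qed
  have up: "s x = n \<Longrightarrow> (s, ?m s n) \<in> ?W\<^sup>*" for s n
  proof (induction n arbitrary: s)
    case 0
    have "s = ?m s 0" by auto
    then show ?case by (metis rtrancl.rtrancl_refl)
  next
    case (Suc n)
    have "(s, ?m s 1) \<in> ?W" using Suc.prems by (simp only: W) simp
    moreover have "?m (?m s 1) n = ?m s (Suc n)" using d by (auto simp: fun_eq_iff)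
    moreover have "(?m s 1, ?m (?m s 1) n) \<in> ?W\<^sup>*" using Suc.prems d by (intro Suc.IH) simp
    ultimately show ?case by (metis (no_types, lifting) converse_rtrancl_into_rtrancl)
  qed
  have "(s, s') \<in> ?W\<^sup>* O test0 x \<longleftrightarrow> (s, s') \<in> drain x y z" for s s'
  proof
    assume "(s, s') \<in> ?W\<^sup>* O test0 x"
    then have "(s, s') \<in> ?W\<^sup>*" "s' x = 0" by (auto simp: in_ops)
    with down obtain k where "k \<le> s x" "s' = ?m s k" "s' x = 0" by blast
    moreover from this have "k = s x" using d by simp
    ultimately show "(s, s') \<in> drain x y z" by (simp add: in_ops)
  next
    assume "(s, s') \<in> drain x y z"
    then show "(s, s') \<in> ?W\<^sup>* O test0 x" using up[OF HOL.refl, of s] d by (auto simp: in_ops)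
  qed
  then have "drain x y z = ?W\<^sup>* O test0 x" by auto
  then show ?thesis
    by (simp add: program.intros program_dec program_inc program_test0)
qed

text \<open>
  Registers can only be emptied into others. Copying \<open>x\<close> therefore makes two copies in scratch
  registers, one of which restores \<open>x\<close>; this order also covers \<open>x = y\<close>.
\<close>
lemma realizable_assign:
  assumes "x < b" "y < b"
  shows "realizable b (assign y x)"
proof -
  let ?Q = "drain x b (b + 1) O drain (b + 1) x (b + 2) O clear (b + 2) O clear y
    O drain b y (b + 2) O clear (b + 2)"
  have "program ?Q"
    using assms by (intro program.seq program_drain program_clear) auto
  then have "realizable b ?Q" by (rule realizable_program)
  then show ?thesis
  proof (rule realizable_cong)
    fix s s' assume "s \<in> clean b"
    then have z: "s b = 0" "s (b + 1) = 0" "s (b + 2) = 0" by (auto simp: clean_def)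
    have "(s, s') \<in> ?Q \<longleftrightarrow> s' = s(y := s x)"
      unfolding in_ops_seq in_ops
      by (rule arg_cong[where f = "\<lambda>u. s' = u"]) (use assms z in \<open>auto simp: fun_eq_iff\<close>)
    then show "(s, s') \<in> ?Q \<longleftrightarrow> (s, s') \<in> assign y x" by (simp add: in_ops)
  qed
qed

text \<open>
  The argument registers form an arbitrary list, which may contain the result register \<open>o'\<close>, so
  that a call can use its arguments in the places where they are.
\<close>
definition evaluate :: "recf \<Rightarrow> nat list \<Rightarrow> nat \<Rightarrow> (store \<times> store) set" where
  "evaluate f rs o' = {(s, s(o' := y)) | s y. rec_eval f (map s rs) y}"

lemma in_evaluate:
  "(s, s') \<in> evaluate f rs o' \<longleftrightarrow> (\<exists>y. rec_eval f (map s rs) y \<and> s' = s(o' := y))"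
  by (auto simp: evaluate_def)

lemma realizable_empty: "realizable b {}"
proof -
  have "inc 0 O test0 0 = {}" by (auto simp: in_ops)
  then show ?thesis
    using realizable_program[OF program.seq[OF program_inc program_test0]] by metis
qed

lemma preserves_basic:
  "r < b \<Longrightarrow> preserves b (inc r)"
  "r < b \<Longrightarrow> preserves b (dec r)"
  "preserves b (test0 r)"
  "preserves b (clear r)"
  "y < b \<Longrightarrow> preserves b (assign y x)"
  "o' < b \<Longrightarrow> preserves b (evaluate f rs o')"
  by (auto simp: preserves_def in_ops in_evaluate clean_def)

definition put_block :: "nat \<Rightarrow> nat list \<Rightarrow> store \<Rightarrow> store" where
  "put_block j ys s = (\<lambda>r. if j \<le> r \<and> r < j + length ys then ys ! (r - j) else s r)"

lemma put_block_Nil [simp]: "put_block j [] s = s"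
  by (auto simp: put_block_def)

lemma put_block_Cons: "put_block j (y # ys) s = put_block (Suc j) ys (s(j := y))"
proof
  fix r
  show "put_block j (y # ys) s r = put_block (Suc j) ys (s(j := y)) r"
    by (cases "r = j") (auto simp: put_block_def nth_Cons' dest: Suc_leI)
qed

lemma realizable_evaluate_list:
  assumes "\<And>g o'. g \<in> set gs \<Longrightarrow> o' < b \<Longrightarrow> realizable b (evaluate g rs o')"
    and "\<forall>r\<in>set rs. r < j" "j + length gs \<le> b"
  shows "realizable b {(s, put_block j ys s) | s ys. list_all2 (\<lambda>g y. rec_eval g (map s rs) y) gs ys}"
  using assms
proof (induction gs arbitrary: j)
  case Nil
  have "{(s, put_block j ys s) | s ys. list_all2 (\<lambda>g y. rec_eval g (map s rs) y) [] ys} = {}\<^sup>*"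
    by auto
  then show ?case using realizable_loop[OF realizable_empty] by (simp add: preserves_def)
next
  case (Cons g gs)
  let ?T = "\<lambda>j gs. {(s, put_block j ys s) | s ys. list_all2 (\<lambda>g y. rec_eval g (map s rs) y) gs ys}"
  have "realizable b (evaluate g rs j)" using Cons.prems by simp
  moreover have "realizable b (?T (Suc j) gs)" using Cons.prems by (intro Cons.IH) auto
  ultimately have "realizable b (evaluate g rs j O ?T (Suc j) gs)"
    using Cons.prems(3) by (intro realizable_seq preserves_basic) simp_all
  moreover have "(s, s') \<in> evaluate g rs j O ?T (Suc j) gs \<longleftrightarrow> (s, s') \<in> ?T j (g # gs)" for s s'
  proof -
    have m: "map (s(j := y)) rs = map s rs" for y
      using Cons.prems(2) by auto
    have "(s, s') \<in> evaluate g rs j O ?T (Suc j) gs \<longleftrightarrow> (\<exists>y. rec_eval g (map s rs) y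
        \<and> (\<exists>ys. list_all2 (\<lambda>g z. rec_eval g (map (s(j := y)) rs) z) gs ys
          \<and> s' = put_block (Suc j) ys (s(j := y))))"
      unfolding relcomp_unfold in_evaluate by blast
    also have "\<dots> \<longleftrightarrow> (\<exists>y ys. rec_eval g (map s rs) y
        \<and> list_all2 (\<lambda>g y. rec_eval g (map s rs) y) gs ys \<and> s' = put_block j (y # ys) s)"
      unfolding m put_block_Cons by blast
    also have "\<dots> \<longleftrightarrow> (s, s') \<in> ?T j (g # gs)"
      by (auto simp: list_all2_Cons1 simp del: fun_upd_apply)
    finally show ?thesis .
  qed
  ultimately show ?case by (rule realizable_cong)
qed

lemma realizable_program_basic:
  "realizable b (inc r)"
  "realizable b (dec r)"
  "realizable b (test0 r)"
  "realizable b (clear r)"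
  by (simp_all add: realizable_program program_clear program_inc program_dec program_test0)

lemma realizable_clear_block: "realizable b {(s, put_block j (replicate k 0) s) | s. True}"
proof (induction k arbitrary: j)
  case 0
  have "{(s, put_block j (replicate 0 0) s) | s. True} = {}\<^sup>*" by auto
  then show ?case using realizable_loop[OF realizable_empty] by (simp add: preserves_def)
next
  case (Suc k)
  have "{(s, put_block j (replicate (Suc k) 0) s) | s. True}
    = clear j O {(s, put_block (Suc j) (replicate k 0) s) | s. True}"
    by (auto simp: put_block_Cons in_ops relcomp_unfold)
  moreover have "program (clear j)" by (rule program_clear)
  moreover obtain R where R: "program R"
    "\<forall>s\<in>clean b. \<forall>s'. (s, s') \<in> R \<longleftrightarrow> (s, s') \<in> {(s, put_block (Suc j) (replicate k 0) s) | s. True}"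
    using Suc[of "Suc j"] unfolding realizable_def by blast
  moreover have "(s(j := 0)) \<in> clean b" if "s \<in> clean b" for s
    using that by (auto simp: clean_def)
  ultimately show ?case unfolding realizable_def
    by (intro exI[of _ "clear j O R"]) (auto simp: program.seq in_ops_seq)
qed

section \<open>Programs for recursive functions\<close>

lemma rec_eval_simps:
  "rec_eval Zero xs z \<longleftrightarrow> z = 0"
  "rec_eval Succ xs z \<longleftrightarrow> (\<exists>x. xs = [x] \<and> z = Suc x)"
  "rec_eval (Proj i) xs z \<longleftrightarrow> i < length xs \<and> z = xs ! i"
  "rec_eval (Comp f gs) xs z \<longleftrightarrow>
    (\<exists>ys. list_all2 (\<lambda>g y. rec_eval g xs y) gs ys \<and> rec_eval f ys z)"
  "rec_eval (PrimRec f g) (0 # xs) z \<longleftrightarrow> rec_eval f xs z"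
  "rec_eval (PrimRec f g) (Suc n # xs) z \<longleftrightarrow>
    (\<exists>y. rec_eval (PrimRec f g) (n # xs) y \<and> rec_eval g (n # y # xs) z)"
  "rec_eval (Mu f) xs z \<longleftrightarrow>
    rec_eval f (z # xs) 0 \<and> (\<forall>m<z. \<exists>y. rec_eval f (m # xs) (Suc y))"
proof -
  show "rec_eval (Comp f gs) xs z \<longleftrightarrow>
    (\<exists>ys. list_all2 (\<lambda>g y. rec_eval g xs y) gs ys \<and> rec_eval f ys z)"
    unfolding list_all2_conv_all_nth
    by (auto intro: rec_eval.comp elim: rec_eval_elims) (metis rec_eval_elims(4))
  show "rec_eval (Mu f) xs z \<longleftrightarrow>
    rec_eval f (z # xs) 0 \<and> (\<forall>m<z. \<exists>y. rec_eval f (m # xs) (Suc y))"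
    by (auto intro: rec_eval.mu elim: rec_eval_elims)
qed (auto intro: rec_eval.intros elim: rec_eval_elims)

lemma rec_eval_PrimRec_Nil: "\<not> rec_eval (PrimRec f g) [] z"
  by (auto elim: rec_eval.cases)

lemma evaluate_empty:
  assumes "\<And>s y. \<not> rec_eval f (map s rs) y"
  shows "realizable b (evaluate f rs o')"
proof -
  have "evaluate f rs o' = {}" using assms by (auto simp: evaluate_def)
  then show ?thesis using realizable_empty by simp
qed

lemma realizable_Comp:
  assumes f: "\<And>rs o' b. (\<forall>r\<in>set rs. r < b) \<Longrightarrow> o' < b \<Longrightarrow> realizable b (evaluate f rs o')"
    and gs: "\<And>g rs o' b. g \<in> set gs \<Longrightarrow> (\<forall>r\<in>set rs. r < b) \<Longrightarrow> o' < b \<Longrightarrow> realizable b (evaluate g rs o')"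
    and rs: "\<forall>r\<in>set rs. r < b" and o': "o' < b"
  shows "realizable b (evaluate (Comp f gs) rs o')"
proof -
  let ?k = "length gs"
  let ?ts = "[b..<b + ?k]"
  let ?L = "{(s, put_block b ys s) | s ys. list_all2 (\<lambda>g y. rec_eval g (map s rs) y) gs ys}"
  let ?E = "evaluate f ?ts o'"
  let ?C = "{(s, put_block b (replicate ?k 0) s) | s. True}"
  have "realizable (b + ?k) ?L"
    by (rule realizable_evaluate_list) (use gs rs in \<open>auto intro!: gs intro: less_le_trans[OF _ le_add1]\<close>)
  moreover have "realizable (b + ?k) ?E" using o' by (intro f) auto
  moreover have "realizable (b + ?k) ?C" by (rule realizable_clear_block)
  ultimately have "realizable (b + ?k) ((?L O ?E) O ?C)"
    using o' by (intro realizable_seq preserves_seq preserves_basic)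
      (auto simp: preserves_def clean_def put_block_def list_all2_lengthD)
  then have "realizable b ((?L O ?E) O ?C)" by (rule realizable_mono) simp
  then show ?thesis
  proof (rule realizable_cong)
    fix s s' assume s: "s \<in> clean b"
    have ts: "map (put_block b ys s) ?ts = ys" if "length ys = ?k" for ys
      using that by (intro nth_equalityI) (auto simp: put_block_def)
    have reset: "put_block b (replicate ?k 0) ((put_block b ys s)(o' := z)) = s(o' := z)"
      if "length ys = ?k" for ys z
      using that s o' by (auto simp: put_block_def fun_eq_iff clean_def)
    have "(s, s') \<in> (?L O ?E) O ?C \<longleftrightarrow> (\<exists>ys z. list_all2 (\<lambda>g y. rec_eval g (map s rs) y) gs ys
      \<and> rec_eval f (map (put_block b ys s) ?ts) z
      \<and> s' = put_block b (replicate ?k 0) ((put_block b ys s)(o' := z)))"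
      unfolding relcomp_unfold in_evaluate by blast
    also have "\<dots> \<longleftrightarrow> (\<exists>ys z. list_all2 (\<lambda>g y. rec_eval g (map s rs) y) gs ys
      \<and> rec_eval f ys z \<and> s' = s(o' := z))"
      by (metis list_all2_lengthD ts reset)
    also have "\<dots> \<longleftrightarrow> (s, s') \<in> evaluate (Comp f gs) rs o'"
      unfolding in_evaluate rec_eval_simps by blast
    finally show "(s, s') \<in> (?L O ?E) O ?C \<longleftrightarrow> (s, s') \<in> evaluate (Comp f gs) rs o'" .
  qed
qed

lemma in_evaluate_seq:
  "(s, s') \<in> evaluate f rs o' O Q \<longleftrightarrow> (\<exists>y. rec_eval f (map s rs) y \<and> (s(o' := y), s') \<in> Q)"
  by (auto simp: evaluate_def relcomp_unfold)

lemma map_store_eq: "(\<And>r. r \<in> set rs \<Longrightarrow> s r = s' r) \<Longrightarrow> map s rs = map s' rs" for s s' :: store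
  by simp

text \<open>
  The first scratch register counts down from the recursion argument while the second counts up
  and the third holds the value of the recursion. After \<open>j\<close> rounds it holds the value at \<open>j\<close>;
  the zero test on the first register selects the round in which \<open>j\<close> is the recursion argument.
\<close>
lemma realizable_PrimRec:
  assumes f: "\<And>rs o' b. (\<forall>r\<in>set rs. r < b) \<Longrightarrow> o' < b \<Longrightarrow> realizable b (evaluate f rs o')"
    and g: "\<And>rs o' b. (\<forall>r\<in>set rs. r < b) \<Longrightarrow> o' < b \<Longrightarrow> realizable b (evaluate g rs o')"
    and rs: "\<forall>r\<in>set rs. r < b" and o': "o' < b"
  shows "realizable b (evaluate (PrimRec f g) rs o')"
proof (cases rs)
  case Nil
  then show ?thesis by (intro evaluate_empty) (simp add: rec_eval_PrimRec_Nil)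
next
  case (Cons n rs')
  have n: "n < b" and rs': "\<forall>r\<in>set rs'. r < b" using rs Cons by auto
  define c i acc where r_defs: "c = b" "i = b + 1" "acc = b + 2"
  let ?b = "b + 3"
  let ?W = "dec c O evaluate g (i # acc # rs') acc O inc i"
  let ?Q = "evaluate f rs' acc O assign c n O ?W\<^sup>* O test0 c O assign o' acc O clear acc O clear i"
  have "realizable ?b (evaluate g (i # acc # rs') acc)"
    using rs' by (intro g) (auto simp: r_defs)
  moreover have "realizable ?b (evaluate f rs' acc)"
    using rs' by (intro f) (auto simp: r_defs)
  moreover have "realizable ?b (assign c n)" "realizable ?b (assign o' acc)"
    using n o' by (auto intro!: realizable_assign simp: r_defs)
  ultimately have "realizable ?b ?Q"
    using o' by (intro realizable_seq realizable_loop realizable_program_basic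
        preserves_seq preserves_loop preserves_basic) (simp_all add: r_defs)
  then have "realizable b ?Q" by (rule realizable_mono) simp
  then show ?thesis
  proof (rule realizable_cong)
    fix s s' assume s: "s \<in> clean b"
    let ?xs = "map s rs'"
    define st where "st = (\<lambda>k j y. s(acc := y, c := k, i := j))"
    have st_simps: "st k j y c = k" "st k j y i = j" "st k j y acc = y" for k j y
      by (auto simp: st_def r_defs)
    have st_rs: "map (st k j y) rs' = ?xs" for k j y
      using rs' by (intro map_store_eq) (auto simp: st_def r_defs)
    have W: "(st k j y, u) \<in> ?W \<longleftrightarrow>
      (\<exists>k' z. k = Suc k' \<and> rec_eval g (j # y # ?xs) z \<and> u = st k' (Suc j) z)" for k j y u
    proof -
      have 1: "(st k j y)(c := k - 1) = st (k - 1) j y"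
        by (auto simp: st_def r_defs fun_eq_iff)
      have 2: "(st k j y)(acc := z, i := Suc j) = st k (Suc j) z" for k z
        by (auto simp: st_def r_defs fun_eq_iff)
      have 3: "i \<noteq> acc" by (simp add: r_defs)
      show ?thesis
        unfolding in_ops_seq in_evaluate_seq in_ops st_simps 1
        using 3 by (cases k) (auto simp: 2 st_simps st_rs simp del: fun_upd_apply, auto simp: 2 st_simps st_rs)
    qed
    have loop: "(st k 0 y0, u) \<in> ?W\<^sup>* \<longleftrightarrow>
      (\<exists>j y. j \<le> k \<and> rec_eval (PrimRec f g) (j # ?xs) y \<and> u = st (k - j) j y)"
      if y0: "rec_eval f ?xs y0" for k y0 u
    proof
      assume "(st k 0 y0, u) \<in> ?W\<^sup>*"
      then show "\<exists>j y. j \<le> k \<and> rec_eval (PrimRec f g) (j # ?xs) y \<and> u = st (k - j) j y"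
      proof (induction rule: rtrancl_induct)
        case base
        show ?case using y0 by (intro exI[of _ 0] exI[of _ y0]) (simp add: rec_eval_simps)
      next
        case (step u v)
        then obtain j y where jy: "j \<le> k" "rec_eval (PrimRec f g) (j # ?xs) y" "u = st (k - j) j y"
          by blast
        with step(2) obtain k' z where "k - j = Suc k'" "rec_eval g (j # y # ?xs) z" "v = st k' (Suc j) z"
          by (auto simp only: W)
        moreover from this have "Suc j \<le> k" "k' = k - Suc j" by auto
        ultimately show ?case using jy(2)
          by (intro exI[of _ "Suc j"] exI[of _ z]) (auto simp: rec_eval_simps)
      qed
    next
      assume "\<exists>j y. j \<le> k \<and> rec_eval (PrimRec f g) (j # ?xs) y \<and> u = st (k - j) j y"
      then obtain j y where jy: "j \<le> k" "rec_eval (PrimRec f g) (j # ?xs) y" "u = st (k - j) j y"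
        by blast
      have "(st k 0 y0, st (k - j) j y) \<in> ?W\<^sup>*" using jy(1,2)
      proof (induction j arbitrary: y)
        case 0
        then have "y = y0" using y0 by (simp add: rec_eval_simps rec_eval_deterministic)
        then show ?case by simp
      next
        case (Suc j)
        then obtain z where z: "rec_eval (PrimRec f g) (j # ?xs) z" "rec_eval g (j # z # ?xs) y"
          by (auto simp: rec_eval_simps)
        have "(st (k - j) j z, st (k - Suc j) (Suc j) y) \<in> ?W"
          unfolding W using Suc.prems(1) z(2) by (intro exI[of _ "k - Suc j"] exI[of _ y]) auto
        moreover have "(st k 0 y0, st (k - j) j z) \<in> ?W\<^sup>*" using Suc.IH[OF _ z(1)] Suc.prems(1) by simp
        ultimately show ?case by (rule rtrancl.rtrancl_into_rtrancl[rotated])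
      qed
      then show "(st k 0 y0, u) \<in> ?W\<^sup>*" using jy(3) by simp
    qed
    have init: "(s(acc := y))(c := (s(acc := y)) n) = st (s n) 0 y" for y
      using n s by (auto simp: st_def r_defs fun_eq_iff clean_def)
    have fin: "(st 0 j y)(o' := y, acc := 0, i := 0) = s(o' := y)" for j y
      using s o' by (auto simp: st_def r_defs fun_eq_iff clean_def)
    have "(s, s') \<in> ?Q \<longleftrightarrow> (\<exists>y0. rec_eval f ?xs y0 \<and> (\<exists>u. (st (s n) 0 y0, u) \<in> ?W\<^sup>*
        \<and> u c = 0 \<and> s' = u(o' := u acc, acc := 0, i := 0)))"
      unfolding in_evaluate_seq in_ops_seq init
      by (simp add: relcomp_unfold[of "?W\<^sup>*"] in_ops_seq in_ops del: fun_upd_apply)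
    also have "\<dots> \<longleftrightarrow> (\<exists>y0. rec_eval f ?xs y0 \<and> (\<exists>j y. j \<le> s n \<and> rec_eval (PrimRec f g) (j # ?xs) y
        \<and> s n - j = 0 \<and> s' = (st (s n - j) j y)(o' := y, acc := 0, i := 0)))"
      by (rule ex_cong1, rule conj_cong[OF HOL.refl], subst loop) (assumption, metis st_simps)
    also have "\<dots> \<longleftrightarrow> (\<exists>y0. rec_eval f ?xs y0 \<and> (\<exists>y. rec_eval (PrimRec f g) (s n # ?xs) y
        \<and> s' = s(o' := y)))"
      by (rule ex_cong1, rule conj_cong[OF HOL.refl]) (metis fin diff_self_eq_0 diff_is_0_eq le_antisym order_refl)
    also have "\<dots> \<longleftrightarrow> (\<exists>y. rec_eval (PrimRec f g) (s n # ?xs) y \<and> s' = s(o' := y))"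
    proof -
      have "\<exists>y0. rec_eval f ?xs y0" if "rec_eval (PrimRec f g) (k # ?xs) y" for k y
        using that by (induction k arbitrary: y) (auto simp: rec_eval_simps)
      then show ?thesis by blast
    qed
    also have "\<dots> \<longleftrightarrow> (s, s') \<in> evaluate (PrimRec f g) rs o'"
      by (simp add: in_evaluate Cons)
    finally show "(s, s') \<in> ?Q \<longleftrightarrow> (s, s') \<in> evaluate (PrimRec f g) rs o'" .
  qed
qed

text \<open>
  A round of the loop requires the value at the current candidate to be a successor: decrementing
  it would fail otherwise. The loop may be left only when the value is zero.
\<close>
lemma realizable_Mu:
  assumes f: "\<And>rs o' b. (\<forall>r\<in>set rs. r < b) \<Longrightarrow> o' < b \<Longrightarrow> realizable b (evaluate f rs o')"
    and rs: "\<forall>r\<in>set rs. r < b" and o': "o' < b"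
  shows "realizable b (evaluate (Mu f) rs o')"
proof -
  define m v where r_defs: "m = b" "v = b + 1"
  let ?b = "b + 2"
  let ?E = "evaluate f (m # rs) v"
  let ?W = "?E O dec v O clear v O inc m"
  let ?Q = "?W\<^sup>* O ?E O test0 v O assign o' m O clear m"
  have "realizable ?b ?E" using rs by (intro f) (auto simp: r_defs)
  moreover have "realizable ?b (assign o' m)"
    using o' by (auto intro!: realizable_assign simp: r_defs)
  ultimately have "realizable ?b ?Q"
    using o' by (intro realizable_seq realizable_loop realizable_program_basic
        preserves_seq preserves_loop preserves_basic) (simp_all add: r_defs)
  then have "realizable b ?Q" by (rule realizable_mono) simp
  then show ?thesis
  proof (rule realizable_cong)
    fix s s' assume s: "s \<in> clean b"
    let ?xs = "map s rs"
    define st where "st = (\<lambda>k. s(m := k))"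
    have st_rs: "map (st k) (m # rs) = k # ?xs" for k
      using rs by (auto simp: st_def r_defs)
    have st0: "s = st 0" using s by (auto simp: st_def r_defs clean_def)
    have upd: "(st k)(v := z, v := w, v := 0, m := l) = st l" "(st k)(v := 0) = st k" for k z w l
      using s by (auto simp: st_def r_defs clean_def fun_eq_iff)
    have m: "m \<noteq> v" "st k m = k" for k by (auto simp: r_defs st_def)
    have W: "(st k, u) \<in> ?W \<longleftrightarrow> (\<exists>y. rec_eval f (k # ?xs) (Suc y)) \<and> u = st (Suc k)" for k u
    proof -
      have 1: "(st k)(v := y, v := a, v := 0, m := Suc (((st k)(v := y, v := a, v := 0)) m)) = st (Suc k)"
        for y a using s by (auto simp: st_def r_defs clean_def fun_eq_iff)
      show ?thesis
        unfolding in_ops_seq in_evaluate_seq in_ops st_rs 1 by (auto simp: gr0_conv_Suc)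
    qed
    have loop: "(st 0, u) \<in> ?W\<^sup>* \<longleftrightarrow>
      (\<exists>k. u = st k \<and> (\<forall>j<k. \<exists>y. rec_eval f (j # ?xs) (Suc y)))" for u
    proof
      assume "(st 0, u) \<in> ?W\<^sup>*"
      then show "\<exists>k. u = st k \<and> (\<forall>j<k. \<exists>y. rec_eval f (j # ?xs) (Suc y))"
      proof (induction rule: rtrancl_induct)
        case (step u w)
        from step.IH obtain k where k: "u = st k" "\<forall>j<k. \<exists>y. rec_eval f (j # ?xs) (Suc y)"
          by blast
        from step(2) have "w = st (Suc k)" "\<exists>y. rec_eval f (k # ?xs) (Suc y)"
          unfolding k(1) W by auto
        with k(2) show ?case by (intro exI[of _ "Suc k"]) (auto simp: less_Suc_eq)
      qed auto
    next
      assume "\<exists>k. u = st k \<and> (\<forall>j<k. \<exists>y. rec_eval f (j # ?xs) (Suc y))"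
      then obtain k where "u = st k" "\<forall>j<k. \<exists>y. rec_eval f (j # ?xs) (Suc y)" by blast
      moreover have "\<forall>j<k. \<exists>y. rec_eval f (j # ?xs) (Suc y) \<Longrightarrow> (st 0, st k) \<in> ?W\<^sup>*"
      proof (induction k)
        case (Suc k)
        then have "(st k, st (Suc k)) \<in> ?W" unfolding W by blast
        then show ?case using Suc by (meson less_SucI rtrancl.rtrancl_into_rtrancl)
      qed simp
      ultimately show "(st 0, u) \<in> ?W\<^sup>*" by simp
    qed
    have fin: "(st k)(o' := k, m := 0) = s(o' := k)" for k
      using s o' by (auto simp: st_def r_defs fun_eq_iff clean_def)
    have "(s, s') \<in> ?Q \<longleftrightarrow> (\<exists>u. (st 0, u) \<in> ?W\<^sup>* \<and> (u, s') \<in> ?E O test0 v O assign o' m O clear m)"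
      unfolding relcomp_unfold[of "?W\<^sup>*"] by (subst st0) blast
    also have "\<dots> \<longleftrightarrow> (\<exists>k. (\<forall>j<k. \<exists>y. rec_eval f (j # ?xs) (Suc y))
        \<and> (st k, s') \<in> ?E O test0 v O assign o' m O clear m)"
      unfolding loop by blast
    also have "\<dots> \<longleftrightarrow> (\<exists>k. (\<forall>j<k. \<exists>y. rec_eval f (j # ?xs) (Suc y))
        \<and> rec_eval f (k # ?xs) 0 \<and> s' = s(o' := k))"
    proof -
      have "(st k, s') \<in> ?E O test0 v O assign o' m O clear m \<longleftrightarrow>
          rec_eval f (k # ?xs) 0 \<and> s' = s(o' := k)" for k
        unfolding in_ops_seq in_evaluate_seq in_ops st_rs
        using m(1) by (auto simp: upd m fin simp del: fun_upd_apply; simp add: m upd fin)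
      then show ?thesis by simp
    qed
    also have "\<dots> \<longleftrightarrow> (s, s') \<in> evaluate (Mu f) rs o'"
      by (auto simp: in_evaluate rec_eval_simps)
    finally show "(s, s') \<in> ?Q \<longleftrightarrow> (s, s') \<in> evaluate (Mu f) rs o'" .
  qed
qed

theorem realizable_evaluate:
  "\<forall>r\<in>set rs. r < b \<Longrightarrow> o' < b \<Longrightarrow> realizable b (evaluate f rs o')"
proof (induction f arbitrary: rs o' b)
  case Zero
  have "clear o' = evaluate Zero rs o'" by (auto simp: in_evaluate rec_eval_simps in_ops)
  then show ?case using realizable_program_basic(4) by metis
next
  case Succ
  show ?case
  proof (cases "\<exists>r. rs = [r]")
    case True
    then obtain r where r: "rs = [r]" ..
    have "(s, s') \<in> assign o' r O inc o' \<longleftrightarrow> (s, s') \<in> evaluate Succ rs o'" for s s'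
      by (simp add: r in_evaluate rec_eval_simps in_ops_seq in_ops)
    moreover have "realizable b (assign o' r O inc o')"
      using Succ r by (intro realizable_seq realizable_assign realizable_program_basic preserves_basic) auto
    ultimately show ?thesis using realizable_cong by blast
  next
    case False
    then show ?thesis by (intro evaluate_empty) (auto simp: rec_eval_simps)
  qed
next
  case (Proj i)
  show ?case
  proof (cases "i < length rs")
    case True
    then have "(s, s') \<in> assign o' (rs ! i) \<longleftrightarrow> (s, s') \<in> evaluate (Proj i) rs o'" for s s'
      by (simp add: in_evaluate rec_eval_simps in_ops)
    moreover have "realizable b (assign o' (rs ! i))"
      using Proj True by (intro realizable_assign) auto
    ultimately show ?thesis using realizable_cong by blast
  next
    case False
    then show ?thesis by (intro evaluate_empty) (auto simp: rec_eval_simps)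
  qed
next
  case (Comp f gs)
  then show ?case by (intro realizable_Comp) auto
next
  case (PrimRec f g)
  then show ?case by (intro realizable_PrimRec) auto
next
  case (Mu f)
  then show ?case by (intro realizable_Mu) auto
qed

text \<open>
  Emptying all registers at the end makes the final store, and hence its code, independent of the
  input.
\<close>
theorem program_accepts_zeros:
  "\<exists>R. program R \<and> (\<forall>n. (\<lambda>r. if r = 0 then n else 0, \<lambda>_. 0) \<in> R \<longleftrightarrow> rec_eval f [n] 0)"
proof -
  have "realizable 2 (evaluate f [0] 1)" by (rule realizable_evaluate) auto
  then have "realizable 2 (evaluate f [0] 1 O test0 1 O clear 0)"
    by (intro realizable_seq realizable_program_basic preserves_basic) auto
  then obtain R where R: "program R" "\<And>s s'. s \<in> clean 2 \<Longrightarrow>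
      (s, s') \<in> R \<longleftrightarrow> (s, s') \<in> evaluate f [0] 1 O test0 1 O clear 0"
    unfolding realizable_def by blast
  show ?thesis
  proof (intro exI[of _ R] conjI allI R(1))
    fix n
    let ?s = "\<lambda>r. if r = 0 then n else (0::nat)"
    have "?s(1 := 0, 0 := 0) = (\<lambda>_. 0)" by auto
    moreover have "?s \<in> clean 2" by (auto simp: clean_def)
    ultimately show "(?s, \<lambda>_. 0) \<in> R \<longleftrightarrow> rec_eval f [n] 0"
      unfolding R(2)[OF \<open>?s \<in> clean 2\<close>] in_evaluate_seq in_ops_seq in_ops by force
  qed
qed

section \<open>Simulating programs by equations in groups\<close>

fun chain :: "nat \<Rightarrow> (nat \<times> nat) list \<Rightarrow> nat \<Rightarrow> bool" where
  "chain N [] N' \<longleftrightarrow> N = N'"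
| "chain N ((x, y) # ps) N' \<longleftrightarrow> N = x \<and> chain y ps N'"

lemma chain_append: "chain N (ps @ qs) N' \<longleftrightarrow> (\<exists>M. chain N ps M \<and> chain M qs N')"
  by (induction ps arbitrary: N) auto

definition nth_prime :: "nat \<Rightarrow> nat" where
  "nth_prime = enumerate {p. prime p}"

lemma prime_nth_prime [simp]: "prime (nth_prime r)"
  using enumerate_in_set[OF primes_infinite, of r] by (simp add: nth_prime_def)

lemma nth_prime_gt_1: "nth_prime r > Suc 0"
  by (rule prime_gt_Suc_0_nat) simp

lemma nth_prime_eq_iff [simp]: "nth_prime r = nth_prime r' \<longleftrightarrow> r = r'"
  using strict_mono_enumerate[OF primes_infinite] by (simp add: nth_prime_def strict_mono_eq)

lemma nth_prime_0: "nth_prime 0 = 2"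
  unfolding nth_prime_def enumerate_0 by (rule Least_equality) (auto dest: prime_ge_2_nat)

definition finite_store :: "store \<Rightarrow> bool" where
  "finite_store s \<longleftrightarrow> finite {r. s r \<noteq> 0}"

text \<open>
  A store is coded by a single number that holds the contents of the registers as exponents of
  distinct primes. Incrementing, decrementing and testing a register become multiplication,
  division and a divisibility test.
\<close>
definition enc :: "store \<Rightarrow> nat" where
  "enc s = (\<Prod>r | s r \<noteq> 0. nth_prime r ^ s r)"

lemma finite_store_upd [simp]: "finite_store (s(r := n)) \<longleftrightarrow> finite_store s"
proof -
  have "{r'. (s(r := n)) r' \<noteq> 0} \<subseteq> insert r {r. s r \<noteq> 0}"
    "{r. s r \<noteq> 0} \<subseteq> insert r {r'. (s(r := n)) r' \<noteq> 0}" by auto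
  then show ?thesis unfolding finite_store_def by (metis finite_insert finite_subset)
qed

lemma enc_superset: "finite A \<Longrightarrow> {r. s r \<noteq> 0} \<subseteq> A \<Longrightarrow> enc s = (\<Prod>r\<in>A. nth_prime r ^ s r)"
  unfolding enc_def by (rule prod.mono_neutral_left) auto

lemma enc_Suc:
  assumes "finite_store s"
  shows "enc (s(r := Suc (s r))) = nth_prime r * enc s"
proof -
  let ?A = "insert r {r. s r \<noteq> 0}"
  have A: "finite ?A" using assms by (simp add: finite_store_def)
  have "enc (s(r := Suc (s r))) = (\<Prod>r'\<in>?A. nth_prime r' ^ (s(r := Suc (s r))) r')"
    using A by (intro enc_superset) auto
  also have "\<dots> = nth_prime r * (nth_prime r ^ s r * (\<Prod>r'\<in>?A - {r}. nth_prime r' ^ (s(r := Suc (s r))) r'))"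
    using A by (subst prod.remove[of _ r]) auto
  also have "(\<Prod>r'\<in>?A - {r}. nth_prime r' ^ (s(r := Suc (s r))) r') = (\<Prod>r'\<in>?A - {r}. nth_prime r' ^ s r')"
    by (rule prod.cong) auto
  also have "nth_prime r ^ s r * \<dots> = (\<Prod>r'\<in>?A. nth_prime r' ^ s r')"
    using A by (subst prod.remove[of _ r]) auto
  also have "\<dots> = enc s" using A by (intro enc_superset[symmetric]) auto
  finally show ?thesis .
qed

lemma nth_prime_dvd_enc:
  assumes "finite_store s"
  shows "nth_prime r dvd enc s \<longleftrightarrow> s r \<noteq> 0"
proof
  assume "nth_prime r dvd enc s"
  then obtain r' where "s r' \<noteq> 0" "nth_prime r dvd nth_prime r' ^ s r'"
    using assms by (auto simp: enc_def finite_store_def prime_dvd_prod_iff)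
  then show "s r \<noteq> 0"
    by (metis prime_dvd_power prime_nth_prime primes_dvd_imp_eq nth_prime_eq_iff)
next
  assume "s r \<noteq> 0"
  then have "nth_prime r dvd nth_prime r ^ s r" by simp
  also have "\<dots> dvd enc s"
    unfolding enc_def using assms \<open>s r \<noteq> 0\<close> by (intro dvd_prodI) (auto simp: finite_store_def)
  finally show "nth_prime r dvd enc s" .
qed

lemma enc_pos: "enc s > 0"
  unfolding enc_def by (rule prod_pos) (simp add: prime_gt_0_nat)

lemma enc_inj:
  assumes "finite_store s" "finite_store s'" "enc s = enc s'"
  shows "s = s'"
proof
  have "multiplicity (nth_prime r) (enc s) = s r" if "finite_store s" for s r
    using that
  proof (induction "s r" arbitrary: s)
    case 0
    then show ?case using nth_prime_dvd_enc[of s r] by (simp add: not_dvd_imp_multiplicity_0)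
  next
    case (Suc n)
    let ?s = "s(r := n)"
    have "s = ?s(r := Suc (?s r))" using Suc.hyps(2) by auto
    then have "enc s = nth_prime r * enc ?s" using enc_Suc[of ?s r] Suc.prems by simp
    moreover have "multiplicity (nth_prime r) (enc ?s) = n" using Suc.hyps(1)[of ?s] Suc.prems by simp
    ultimately show ?case
      using Suc.hyps(2) enc_pos[of ?s] multiplicity_times_same[of "enc ?s" "nth_prime r"] nth_prime_gt_1[of r]
      by simp
  qed
  then show "s r = s' r" for r using assms by metis
qed

lemma enc_zero: "enc (\<lambda>_. 0) = 1"
  by (simp add: enc_def)

lemma enc_input: "enc (\<lambda>r. if r = 0 then n else 0) = 2 ^ n"
  by (subst enc_superset[of "{0}"]) (auto simp: nth_prime_0)

text \<open>
  The four elements satisfy the relations of the right-angled Artin group of the path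
  \<open>a\<close>--\<open>b\<close>--\<open>c\<close>--\<open>d\<close>.
\<close>
locale commuting_path = generated_group +
  fixes a b c d :: 'a
  assumes rational_abcd: "rational {a}" "rational {b}" "rational {c}" "rational {d}"
    and rational_inv_abcd: "rational {inv a}" "rational {inv b}" "rational {inv c}" "rational {inv d}"
    and ab: "a \<otimes> b = b \<otimes> a" and bc: "b \<otimes> c = c \<otimes> b" and cd: "c \<otimes> d = d \<otimes> c"
begin

lemma abcd_closed [simp]: "a \<in> carrier G" "b \<in> carrier G" "c \<in> carrier G" "d \<in> carrier G"
  using rational_abcd[THEN rational_closed] by auto

text \<open>
  In \<open>vprod\<close> the exponents of \<open>b\<close> and \<open>c\<close> within one block stand for the numbers before and after
  one step of a program, and a finite automaton can check how they are related. In \<open>uprod\<close> the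
  exponents of \<open>c\<close> and \<open>b\<close> within one block coincide. Comparing the two products transfers the
  second number of a step to the first number of the next one.
\<close>
primrec vprod :: "(nat \<times> nat) list \<Rightarrow> 'a" where
  "vprod [] = \<one>"
| "vprod (p # ps) = a \<otimes> (b [^] fst p \<otimes> (c [^] snd p \<otimes> (d \<otimes> vprod ps)))"

primrec uprod :: "nat list \<Rightarrow> 'a" where
  "uprod [] = \<one>"
| "uprod (n # ns) = c [^] n \<otimes> (b [^] n \<otimes> (a \<otimes> (d \<otimes> uprod ns)))"

lemma vprod_closed [simp]: "vprod ps \<in> carrier G"
  by (induction ps) auto

lemma uprod_closed [simp]: "uprod ns \<in> carrier G"
  by (induction ns) auto

lemma vprod_append: "vprod (ps @ qs) = vprod ps \<otimes> vprod qs"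
  by (induction ps) (auto simp: m_assoc)

lemma uprod_append: "uprod (ms @ ns) = uprod ms \<otimes> uprod ns"
  by (induction ms) (auto simp: m_assoc)

lemma pow_commutes:
  assumes "x \<otimes> y = y \<otimes> x" "x \<in> carrier G" "y \<in> carrier G" "z \<in> carrier G"
  shows "x [^] (n :: nat) \<otimes> (y \<otimes> z) = y \<otimes> (x [^] n \<otimes> z)"
  using assms group_commutes_pow[of x y n] by (simp add: m_assoc[symmetric])

text \<open>
  Moving \<open>a\<close> across \<open>b [^] N\<close> and \<open>d\<close> across \<open>c [^] y\<close> splits off the first block of \<open>uprod\<close> and
  leaves the same equation for the rest of the chain, with \<open>y\<close> in place of \<open>N\<close>.
\<close>
lemma chain_equation:
  "chain N ps N' \<Longrightarrow> c [^] N \<otimes> vprod ps = uprod (map fst ps) \<otimes> c [^] N'"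
proof (induction ps arbitrary: N)
  case (Cons p ps)
  then obtain y where p: "p = (N, y)" "chain y ps N'" by (cases p) auto
  have "c [^] N \<otimes> vprod (p # ps) = c [^] N \<otimes> (a \<otimes> (b [^] N \<otimes> (d \<otimes> (c [^] y \<otimes> vprod ps))))"
    using pow_commutes[OF cd, of "vprod ps" y] by (simp add: p)
  also have "\<dots> = c [^] N \<otimes> (b [^] N \<otimes> (a \<otimes> (d \<otimes> (c [^] y \<otimes> vprod ps))))"
    using pow_commutes[OF ab[symmetric], of "d \<otimes> (c [^] y \<otimes> vprod ps)" N] by simp
  also have "c [^] y \<otimes> vprod ps = uprod (map fst ps) \<otimes> c [^] N'" by (rule Cons.IH[OF p(2)])
  finally show ?case by (simp add: p m_assoc)
qed simp

text \<open>
  As \<open>b\<close> and \<open>c\<close> commute, both exponents grow together in the powers of \<open>b [^] m \<otimes> c [^] n\<close>. The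
  steps of programs are finite unions of such blocks, for instance all \<open>(k, p * k)\<close> for an
  increment.
\<close>
lemma rational_linear_block:
  "rational (range (\<lambda>k. vprod [(i + m * k, j + n * k)]))"
proof -
  have eq: "vprod [(i + m * k, j + n * k)] = (a \<otimes> b [^] i \<otimes> c [^] j) \<otimes> (b [^] m \<otimes> c [^] n) [^] k \<otimes> d" for k
  proof -
    have bc': "b [^] x \<otimes> c [^] y = c [^] y \<otimes> b [^] x" for x y :: nat
      using group_commutes_pow[OF bc, of x] group_commutes_pow[of c "b [^] x" y] by simp
    have "(b [^] m \<otimes> c [^] n) [^] k = b [^] (m * k) \<otimes> c [^] (n * k)"
      using bc' by (simp add: pow_mult_distrib nat_pow_pow)
    moreover have "c [^] j \<otimes> (b [^] (m * k) \<otimes> (c [^] (n * k) \<otimes> d))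
        = b [^] (m * k) \<otimes> (c [^] j \<otimes> (c [^] (n * k) \<otimes> d))"
      using bc'[of "m * k" j] by (simp add: m_assoc[symmetric])
    ultimately show ?thesis by (simp add: nat_pow_mult[symmetric] m_assoc)
  qed
  have "rational ({a \<otimes> b [^] i \<otimes> c [^] j} <#> range (\<lambda>k :: nat. (b [^] m \<otimes> c [^] n) [^] k) <#> {d})"
    by (intro rational.product rational_powers rational_mult rational_pow rational_abcd)
  also have "{a \<otimes> b [^] i \<otimes> c [^] j} <#> range (\<lambda>k :: nat. (b [^] m \<otimes> c [^] n) [^] k) <#> {d}
      = range (\<lambda>k. vprod [(i + m * k, j + n * k)])"
    unfolding eq by (auto simp: set_mult_def)
  finally show ?thesis .
qed

text \<open>
  \<open>T\<close> is a set of possible histories of the program \<open>R\<close>, as lists of steps between codes of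
  stores. A history need not be a chain; those that are chains from the code of a store are
  exactly the computations of \<open>R\<close> from this store. The condition that histories are chains is
  left to the equation in the group; without it they form a rational subset.
\<close>
definition simulates :: "(nat \<times> nat) list set \<Rightarrow> (store \<times> store) set \<Rightarrow> bool" where
  "simulates T R \<longleftrightarrow> rational (vprod ` T) \<and>
    (\<forall>s s'. finite_store s \<and> (s, s') \<in> R \<longrightarrow>
      finite_store s' \<and> (\<exists>ps\<in>T. chain (enc s) ps (enc s'))) \<and>
    (\<forall>s ps N. finite_store s \<and> ps \<in> T \<and> chain (enc s) ps N \<longrightarrow>
      (\<exists>s'. finite_store s' \<and> N = enc s' \<and> (s, s') \<in> R))"

lemma simulatesI:
  assumes "rational (vprod ` T)"
    and "\<And>s s'. finite_store s \<Longrightarrow> (s, s') \<in> R \<Longrightarrow>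
      finite_store s' \<and> (\<exists>ps\<in>T. chain (enc s) ps (enc s'))"
    and "\<And>s ps N. finite_store s \<Longrightarrow> ps \<in> T \<Longrightarrow> chain (enc s) ps N \<Longrightarrow>
      \<exists>s'. finite_store s' \<and> N = enc s' \<and> (s, s') \<in> R"
  shows "simulates T R"
  using assms unfolding simulates_def by blast

lemma simulates_increment:
  "simulates (range (\<lambda>k. [(k, nth_prime r * k)])) {(s, s(r := Suc (s r))) | s. True}"
proof -
  have "rational (vprod ` range (\<lambda>k. [(k, nth_prime r * k)]))"
    using rational_linear_block[of 0 1 0 "nth_prime r"] by (simp add: image_image)
  then show ?thesis unfolding simulates_def by (auto simp: enc_Suc)
qed

lemma simulates_decrement:
  "simulates (range (\<lambda>k. [(nth_prime r * k, k)])) {(s(r := Suc (s r)), s) | s. True}"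
proof -
  have "rational (vprod ` range (\<lambda>k. [(nth_prime r * k, k)]))"
    using rational_linear_block[of 0 "nth_prime r" 0 1] by (simp add: image_image)
  moreover have "\<exists>s'. finite_store s' \<and> k = enc s' \<and> s = s'(r := Suc (s' r))"
    if s: "finite_store s" "enc s = nth_prime r * k" for s k
  proof -
    let ?s = "s(r := s r - 1)"
    have "s r \<noteq> 0" using nth_prime_dvd_enc[OF s(1), of r] s(2) by simp
    then have eq: "s = ?s(r := Suc (?s r))" by (auto simp: fun_eq_iff)
    then have "enc s = nth_prime r * enc ?s" using enc_Suc[of ?s r] s(1) by simp
    then have "k = enc ?s" using s(2) prime_gt_0_nat[OF prime_nth_prime[of r]] by simp
    then show ?thesis using eq s(1) by (intro exI[of _ ?s]) auto
  qed
  ultimately show ?thesis unfolding simulates_def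
    by (auto simp: enc_Suc simp del: fun_upd_apply)
qed

text \<open>
  Non-divisibility by a prime is membership in one of finitely many residue classes, each of
  which is a linear block.
\<close>
lemma simulates_zero_test:
  "simulates ((\<lambda>n. [(n, n)]) ` {n. \<not> nth_prime r dvd n}) {(s, s) | s. s r = 0}"
proof -
  let ?T = "(\<lambda>n. [(n, n)]) ` {n. \<not> nth_prime r dvd n}"
  have "vprod ` ?T = (\<Union>j\<in>{1..<nth_prime r}. range (\<lambda>k. vprod [(j + nth_prime r * k, j + nth_prime r * k)]))"
  proof (intro equalityI subsetI)
    fix x assume "x \<in> vprod ` ?T"
    then obtain n where n: "\<not> nth_prime r dvd n" "x = vprod [(n, n)]" by blast
    then have "n mod nth_prime r \<in> {1..<nth_prime r}" "n = n mod nth_prime r + nth_prime r * (n div nth_prime r)"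
      by (auto simp: mod_greater_zero_iff_not_dvd Suc_le_eq prime_gt_0_nat)
    then show "x \<in> (\<Union>j\<in>{1..<nth_prime r}. range (\<lambda>k. vprod [(j + nth_prime r * k, j + nth_prime r * k)]))"
      using n(2) by (intro UN_I[of "n mod nth_prime r"] range_eqI[of _ _ "n div nth_prime r"]) auto
  next
    fix x assume "x \<in> (\<Union>j\<in>{1..<nth_prime r}. range (\<lambda>k. vprod [(j + nth_prime r * k, j + nth_prime r * k)]))"
    then obtain j k where j: "j \<in> {1..<nth_prime r}" "x = vprod [(j + nth_prime r * k, j + nth_prime r * k)]" by blast
    then have "\<not> nth_prime r dvd j + nth_prime r * k" by (auto simp: dvd_add_left_iff dest: dvd_imp_le)
    then show "x \<in> vprod ` ?T" using j(2) by blast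
  qed
  then have "rational (vprod ` ?T)"
    by (simp only:) (intro rational_finite_Union rational_linear_block; simp)
  then show ?thesis unfolding simulates_def by (auto simp: nth_prime_dvd_enc)
qed

lemma simulates_seq:
  assumes "simulates T R" "simulates U S"
  shows "simulates ((\<lambda>(ps, qs). ps @ qs) ` (T \<times> U)) (R O S)"
proof -
  have "vprod ` (\<lambda>(ps, qs). ps @ qs) ` (T \<times> U) = vprod ` T <#> vprod ` U"
    by (force simp: set_mult_def vprod_append image_iff)
  moreover have "rational (vprod ` T <#> vprod ` U)"
    using assms by (intro rational.product) (auto simp: simulates_def)
  moreover have "finite_store s' \<and> (\<exists>ps\<in>((\<lambda>(ps, qs). ps @ qs) ` (T \<times> U)). chain (enc s) ps (enc s'))"
    if "finite_store s" "(s, s') \<in> R O S" for s s'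
  proof -
    from that(2) obtain u where "(s, u) \<in> R" "(u, s') \<in> S" by blast
    with that(1) assms obtain ps qs where "finite_store s'" "ps \<in> T" "qs \<in> U"
      "chain (enc s) ps (enc u)" "chain (enc u) qs (enc s')"
      unfolding simulates_def by blast
    then show ?thesis by (force simp: chain_append)
  qed
  moreover have "\<exists>s'. finite_store s' \<and> N = enc s' \<and> (s, s') \<in> R O S"
    if "finite_store s" "ps \<in> (\<lambda>(ps, qs). ps @ qs) ` (T \<times> U)" "chain (enc s) ps N" for s ps N
  proof -
    from that(2,3) obtain ps' qs M where "ps' \<in> T" "qs \<in> U" "chain (enc s) ps' M" "chain M qs N"
      by (auto simp: chain_append)
    with that(1) assms show ?thesis unfolding simulates_def by (metis relcomp.relcompI)
  qed
  ultimately show ?thesis by (intro simulatesI) (simp_all only:)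
qed

lemma simulates_loop:
  assumes "simulates T R"
  shows "simulates (concat ` lists T) (R\<^sup>*)"
proof -
  have "vprod (concat pss) \<in> submonoid (vprod ` T)" if "pss \<in> lists T" for pss
    using that by (induction pss) (auto simp: vprod_append intro: submonoid.intros)
  moreover have "x \<in> vprod ` concat ` lists T" if "x \<in> submonoid (vprod ` T)" for x
    using that
  proof (induction rule: submonoid.induct)
    case one
    show ?case by (rule image_eqI[of _ _ "[]"]) (auto intro!: image_eqI[of _ _ "[]"])
  next
    case (step x y)
    then obtain ps pss where "ps \<in> T" "x = vprod ps" "pss \<in> lists T" "y = vprod (concat pss)" by auto
    then have "x \<otimes> y = vprod (concat (ps # pss))" "ps # pss \<in> lists T" by (auto simp: vprod_append)
    then show ?case by blast
  qed
  ultimately have "vprod ` concat ` lists T = submonoid (vprod ` T)" by blast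
  moreover have "rational (submonoid (vprod ` T))"
    using assms by (intro rational.star) (simp add: simulates_def)
  moreover have "finite_store s' \<and> (\<exists>ps\<in>concat ` lists T. chain (enc s) ps (enc s'))"
    if "finite_store s" "(s, s') \<in> R\<^sup>*" for s s'
    using that(2,1)
  proof (induction rule: converse_rtrancl_induct)
    case base
    then show ?case by (auto intro!: bexI[of _ "[]"])
  next
    case (step s u)
    from step.hyps(1) step.prems assms obtain ps where
      ps: "finite_store u" "ps \<in> T" "chain (enc s) ps (enc u)" unfolding simulates_def by blast
    with step.IH obtain pss where "finite_store s'" "pss \<in> lists T"
      "chain (enc u) (concat pss) (enc s')" by blast
    with ps have "chain (enc s) (concat (ps # pss)) (enc s')" "ps # pss \<in> lists T"
      by (auto simp: chain_append)
    with \<open>finite_store s'\<close> show ?case by blast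
  qed
  moreover have "\<exists>s'. finite_store s' \<and> N = enc s' \<and> (s, s') \<in> R\<^sup>*"
    if "finite_store s" "pss \<in> lists T" "chain (enc s) (concat pss) N" for s pss N
    using that(2,1,3)
  proof (induction pss arbitrary: s)
    case Nil
    then show ?case by auto
  next
    case (Cons ps pss)
    then obtain M where "chain (enc s) ps M" and M: "chain M (concat pss) N" by (auto simp: chain_append)
    with Cons assms obtain u where u: "finite_store u" "M = enc u" "(s, u) \<in> R"
      unfolding simulates_def by (metis in_listsD list.set_intros(1))
    with Cons.IH[of u] M Cons.hyps obtain s' where "finite_store s'" "N = enc s'" "(u, s') \<in> R\<^sup>*" by auto
    with u(3) have "(s, s') \<in> R\<^sup>*" by (simp add: converse_rtrancl_into_rtrancl)
    with \<open>finite_store s'\<close> \<open>N = enc s'\<close> show ?case by blast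
  qed
  ultimately show ?thesis by (intro simulatesI) (simp only: | blast)+
qed

theorem program_simulated: "program R \<Longrightarrow> \<exists>T. simulates T R"
  by (induction rule: program.induct)
    (blast intro: simulates_increment simulates_decrement simulates_zero_test simulates_seq simulates_loop)+

text \<open>
  The elements \<open>inv (uprod ns)\<close> form a submonoid because \<open>ns\<close> is arbitrary: reversing the order of
  the blocks under inversion does no harm.
\<close>
lemma inv_uprod_rational:
  "rational {inv (uprod ns) | ns. True}"
proof -
  let ?K = "{inv (uprod [n]) | n. True}"
  have K: "inv (uprod [n]) = inv d \<otimes> inv a \<otimes> (inv b \<otimes> inv c) [^] n" for n
  proof -
    have "inv b \<otimes> inv c = inv c \<otimes> inv b" by (simp add: inv_mult_group[symmetric] bc)
    then have "(inv b \<otimes> inv c) [^] n = inv (b [^] n) \<otimes> inv (c [^] n)"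
      using pow_mult_distrib[of "inv b" "inv c" n] by (simp add: nat_pow_inv)
    then show ?thesis by (simp add: inv_mult_group m_assoc)
  qed
  have "rational ({inv d \<otimes> inv a} <#> range (\<lambda>n :: nat. (inv b \<otimes> inv c) [^] n))"
    by (intro rational.product rational_powers rational_mult rational_inv_abcd)
  also have "{inv d \<otimes> inv a} <#> range (\<lambda>n :: nat. (inv b \<otimes> inv c) [^] n) = ?K"
    unfolding K by (auto simp: set_mult_def)
  finally have "rational (submonoid ?K)" by (rule rational.star)
  also have "submonoid ?K = {inv (uprod ns) | ns. True}"
  proof (intro equalityI subsetI)
    fix x assume "x \<in> submonoid ?K"
    then show "x \<in> {inv (uprod ns) | ns. True}"
    proof (induction rule: submonoid.induct)
      case one
      show ?case by (intro CollectI exI[of _ "[]"]) simp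
    next
      case (step x y)
      then obtain n ns where "x = inv (uprod [n])" "y = inv (uprod ns)" by blast
      then have "x \<otimes> y = inv (uprod (ns @ [n]))" by (simp add: uprod_append inv_mult_group del: uprod.simps)
      then show ?case by blast
    qed
  next
    fix x assume "x \<in> {inv (uprod ns) | ns. True}"
    then obtain ns where "x = inv (uprod ns)" by blast
    moreover have "inv (uprod ns) \<in> submonoid ?K"
    proof (induction ns rule: rev_induct)
      case (snoc n ns)
      have "inv (uprod (ns @ [n])) = inv (uprod [n]) \<otimes> inv (uprod ns)"
        by (simp add: uprod_append inv_mult_group del: uprod.simps)
      then show ?case using snoc by (auto intro: submonoid.step)
    qed (simp add: submonoid.one)
    ultimately show "x \<in> submonoid ?K" by simp
  qed
  finally show ?thesis .
qed

end

text \<open>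
  The additional assumption is the converse of \<open>chain_equation\<close>: the equation forces the
  numbers in consecutive blocks to match.
\<close>
locale faithful_commuting_path = commuting_path +
  assumes faithful: "c [^] N \<otimes> vprod ps = uprod ns \<otimes> c [^] N' \<Longrightarrow> chain N ps N'"
begin

text \<open>
  For the converse program, which starts from the empty store with code \<open>1\<close>, the equation
  \<open>c \<otimes> vprod ps = uprod ns \<otimes> c [^] (2 ^ n)\<close> can be solved for the power of \<open>c\<close> that codes the input.
\<close>
theorem program_rational_subset:
  assumes "program R"
  shows "\<exists>S. rational S \<and>
    (\<forall>n. c [^] (2 ^ n :: nat) \<in> S \<longleftrightarrow> (\<lambda>r. if r = 0 then n else 0, \<lambda>_. 0) \<in> R)"
proof -
  obtain T where T: "simulates T (R\<inverse>)"
    using program_simulated program_converse[OF assms] by blast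
  let ?S = "{inv (uprod ns) | ns. True} <#> {c} <#> vprod ` T"
  have "rational ?S" using T
    by (intro rational.product inv_uprod_rational rational_abcd) (simp add: simulates_def)
  moreover have "c [^] (2 ^ n :: nat) \<in> ?S \<longleftrightarrow> (\<lambda>r. if r = 0 then n else 0, \<lambda>_. 0) \<in> R" for n
  proof -
    let ?i = "\<lambda>r. if r = 0 then n else (0 :: nat)" and ?z = "\<lambda>_. 0 :: nat"
    have fs: "finite_store ?i" "finite_store ?z"
      using finite_subset[of "{r. ?i r \<noteq> 0}" "{0}"] by (auto simp: finite_store_def)
    have eq: "c [^] N = inv (uprod ns) \<otimes> c \<otimes> vprod ps \<longleftrightarrow>
        c [^] (1 :: nat) \<otimes> vprod ps = uprod ns \<otimes> c [^] N" for N :: nat and ns ps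
      using inv_solve_left[of "c [^] N" "uprod ns" "c \<otimes> vprod ps"] by (simp add: m_assoc eq_commute)
    have "c [^] (2 ^ n :: nat) \<in> ?S \<longleftrightarrow>
        (\<exists>ns. \<exists>ps\<in>T. c [^] (2 ^ n :: nat) = inv (uprod ns) \<otimes> c \<otimes> vprod ps)"
      by (auto simp: set_mult_def)
    also have "\<dots> \<longleftrightarrow> (\<exists>ps\<in>T. chain 1 ps (2 ^ n))"
      unfolding eq using faithful chain_equation by blast
    also have "\<dots> \<longleftrightarrow> (\<exists>ps\<in>T. chain (enc ?z) ps (enc ?i))"
      by (simp only: enc_zero enc_input)
    also have "\<dots> \<longleftrightarrow> (?z, ?i) \<in> R\<inverse>"
      using T fs enc_inj[OF fs(1)] unfolding simulates_def by metis
    finally show ?thesis by simp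
  qed
  ultimately show ?thesis by blast
qed

end

section \<open>The one-relator group\<close>

definition commutator_word :: "nat word" where
  "commutator_word = [Inl 0, Inl 1, Inl 0, Inr 1, Inr 0, Inl 1, Inr 0, Inr 1]"

text \<open>
  The generator \<open>1\<close> is to keep its numeral form in terms such as \<open>gamma 1\<close>.
\<close>
declare One_nat_def [simp del]

definition gens :: "nat set" where
  "gens = {0, 1}"

definition rels :: "(nat word \<times> nat word) set" where
  "rels = {(commutator_word, [])}"

lemma gens [simp]: "0 \<in> gens" "1 \<in> gens"
  by (simp_all add: gens_def)

abbreviation Gamma :: "nat word set monoid" where "Gamma \<equiv> presented_group gens rels"
abbreviation gamma :: "nat \<Rightarrow> nat word set" where "gamma \<equiv> pres_gen gens rels"

lemma commutator_word_in_words: "commutator_word \<in> words gens"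
  by (auto simp: commutator_word_def)

lemma rels_words: "rels \<subseteq> words gens \<times> words gens"
  using commutator_word_in_words by (auto simp: rels_def)

type_synonym point = "int \<times> rat \<times> rat"

text \<open>
  The generator \<open>x = 0\<close> will act on pairs with index \<open>i\<close> by \<open>sigma i\<close>, and \<open>t = 1\<close> lowers the
  index. Hence \<open>t\<^sup>i x t\<^sup>-\<^sup>i\<close> acts on pairs with index \<open>0\<close> by \<open>sigma i\<close>, and the relator acts trivially
  as soon as consecutive \<open>sigma i\<close> commute, which holds because even and odd indices concern
  different coordinates. On each coordinate the maps doubling a number and doubling it plus
  one generate a free monoid, so that the product of such maps can be read off from its values.
\<close>
fun sigma :: "int \<Rightarrow> rat \<times> rat \<Rightarrow> rat \<times> rat" where
  "sigma i (x, y) =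
    (if i = -2 then (2 * x + 1, y) else if i = -1 then (x, 2 * y)
     else if i = 0 then (2 * x, y) else if i = 1 then (x, 2 * y + 1) else (x, y))"

fun sigma_inv :: "int \<Rightarrow> rat \<times> rat \<Rightarrow> rat \<times> rat" where
  "sigma_inv i (x, y) =
    (if i = -2 then ((x - 1) / 2, y) else if i = -1 then (x, y / 2)
     else if i = 0 then (x / 2, y) else if i = 1 then (x, (y - 1) / 2) else (x, y))"

lemma sigma_inverse [simp]: "sigma i (sigma_inv i q) = q" "sigma_inv i (sigma i q) = q"
  by (cases q; simp add: field_simps)+

lemma sigma_commute: "sigma i (sigma (i + 1) q) = sigma (i + 1) (sigma i q)"
  by (cases q) auto

fun act :: "nat + nat \<Rightarrow> point \<Rightarrow> point" where
  "act (Inl n) (i, q) = (if n = 0 then (i, sigma i q) else (i - 1, q))"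
| "act (Inr n) (i, q) = (if n = 0 then (i, sigma_inv i q) else (i + 1, q))"

lemma act_inv_letter: "act l (act (inv_letter l) z) = z"
  by (cases z rule: prod.exhaust; cases l) simp_all

lemma act_commutator_word: "foldr act commutator_word z = z"
proof -
  obtain i q where z: "z = (i, q)" by (cases z)
  have "sigma i (sigma (i + 1) (sigma_inv i (sigma_inv (i + 1) q))) = q"
    by (simp only: sigma_commute sigma_inverse)
  then show ?thesis by (simp add: commutator_word_def z)
qed

lemma pres_eq_act: "pres_eq gens rels u v \<Longrightarrow> foldr act u z = foldr act v z"
proof (induction arbitrary: z rule: pres_eq.induct)
  case (cancel u v l)
  then show ?case by (simp add: act_inv_letter)
next
  case (relation u v r s)
  then show ?case by (simp add: act_commutator_word rels_def)
qed auto

text \<open>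
  Any representative of an element may be chosen, since equal elements act equally.
\<close>
definition group_act :: "nat word set \<Rightarrow> point \<Rightarrow> point" where
  "group_act U = foldr act (SOME u. u \<in> U)"

lemma group_act_class:
  assumes "u \<in> words gens"
  shows "group_act (pres_rel gens rels `` {u}) = foldr act u"
proof
  fix z
  have "u \<in> pres_rel gens rels `` {u}" using assms by (simp add: pres_rel_def pres_eq.refl)
  then have "(SOME v. v \<in> pres_rel gens rels `` {u}) \<in> pres_rel gens rels `` {u}" by (rule someI)
  then show "group_act (pres_rel gens rels `` {u}) z = foldr act u z"
    unfolding group_act_def by (simp add: pres_rel_def pres_eq_act)
qed

lemma group_act_word: "w \<in> words gens \<Longrightarrow> group_act (word_val Gamma gamma w) = foldr act w"
  by (simp add: word_val_presented_group[OF rels_words] group_act_class)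

lemma group_act_one: "group_act \<one>\<^bsub>Gamma\<^esub> z = z"
  using group_act_word[of "[]"] by simp

lemma group_act_mult:
  assumes "x \<in> carrier Gamma" "y \<in> carrier Gamma"
  shows "group_act (x \<otimes>\<^bsub>Gamma\<^esub> y) z = group_act x (group_act y z)"
proof -
  obtain u v where "u \<in> words gens" "x = pres_rel gens rels `` {u}"
    "v \<in> words gens" "y = pres_rel gens rels `` {v}"
    using assms unfolding carrier_presented_group by blast
  then show ?thesis by (simp add: presented_group_mult[OF rels_words] group_act_class)
qed

interpretation Gamma: generated_group Gamma gens gamma
proof (intro generated_group.intro generated_group_axioms.intro)
  show "group Gamma" by (rule group_presented_group[OF rels_words])
  show "gamma x \<in> carrier Gamma" if "x \<in> gens" for x
    using that by (auto simp: pres_gen_def carrier_presented_group)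
  show "gens \<noteq> {}" by (simp add: gens_def)
qed

lemma (in generated_group) rational_word: "w \<in> words X \<Longrightarrow> rational {word_val G g w}"
  by (induction w) (auto intro: rational_one rational_mult rational.letter)

lemma (in generated_group) word_val_append:
  "u \<in> words X \<Longrightarrow> v \<in> words X \<Longrightarrow> word_val G g (u @ v) = word_val G g u \<otimes> word_val G g v"
  by (induction u) (auto simp: word_val_closed m_assoc)

lemma (in generated_group) word_val_inverse:
  "w \<in> words X \<Longrightarrow> word_val G g (rev (map inv_letter w)) = inv (word_val G g w)"
proof (induction w)
  case (Cons l w)
  then have "rev (map inv_letter w) \<in> words X" by (auto simp: words_def in_lists_conv_set)
  with Cons show ?case by (simp add: word_val_append inv_mult_group word_val_closed val_inv)
qed simp

lemma (in generated_group) rational_inv_word: "w \<in> words X \<Longrightarrow> rational {inv (word_val G g w)}"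
  using rational_word[of "rev (map inv_letter w)"]
  by (simp add: word_val_inverse) (auto simp: words_def in_lists_conv_set)

text \<open>
  Conjugates of the generator \<open>0\<close> by the powers \<open>-2, -1, 0, 1\<close> of the generator \<open>1\<close>. This choice of
  exponents makes the third of them the generator itself, so that its powers are the simplest
  possible input words.
\<close>
definition word_a :: "nat word" where
  "word_a = [Inr 1, Inr 1, Inl 0, Inl 1, Inl 1]"

definition word_b :: "nat word" where
  "word_b = [Inr 1, Inl 0, Inl 1]"

definition word_c :: "nat word" where
  "word_c = [Inl 0]"

definition word_d :: "nat word" where
  "word_d = [Inl 1, Inl 0, Inr 1]"

lemmas path_words = word_a_def word_b_def word_c_def word_d_def

lemma path_words_in_words: "word_a \<in> words gens" "word_b \<in> words gens" "word_c \<in> words gens" "word_d \<in> words gens"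
  by (auto simp: path_words)

lemma (in group) conjugate_commutes:
  assumes "x \<otimes> y = y \<otimes> x" "x \<in> carrier G" "y \<in> carrier G" "t \<in> carrier G"
  shows "(inv t \<otimes> x \<otimes> t) \<otimes> (inv t \<otimes> y \<otimes> t) = (inv t \<otimes> y \<otimes> t) \<otimes> (inv t \<otimes> x \<otimes> t)"
proof -
  have c: "t \<otimes> (inv t \<otimes> z) = z" if "z \<in> carrier G" for z
    using that assms(4) by (simp add: m_assoc[symmetric])
  have "x \<otimes> (y \<otimes> t) = y \<otimes> (x \<otimes> t)" using assms by (simp add: m_assoc[symmetric])
  then show ?thesis using assms by (simp add: m_assoc c)
qed

abbreviation "wv \<equiv> word_val Gamma gamma"

lemma conj_words:
  "wv word_b = inv\<^bsub>Gamma\<^esub> (gamma 1) \<otimes>\<^bsub>Gamma\<^esub> wv word_c \<otimes>\<^bsub>Gamma\<^esub> gamma 1"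
  "wv word_c = inv\<^bsub>Gamma\<^esub> (gamma 1) \<otimes>\<^bsub>Gamma\<^esub> wv word_d \<otimes>\<^bsub>Gamma\<^esub> gamma 1"
  "wv word_a = inv\<^bsub>Gamma\<^esub> (gamma 1) \<otimes>\<^bsub>Gamma\<^esub> wv word_b \<otimes>\<^bsub>Gamma\<^esub> gamma 1"
proof -
  have g: "gamma 0 \<in> carrier Gamma" "gamma 1 \<in> carrier Gamma" by (simp_all add: Gamma.gen_closed)
  have c: "inv\<^bsub>Gamma\<^esub> (gamma 1) \<otimes>\<^bsub>Gamma\<^esub> (gamma 1 \<otimes>\<^bsub>Gamma\<^esub> z) = z" if "z \<in> carrier Gamma" for z
    using that g by (simp add: Gamma.m_assoc[symmetric])
  show "wv word_b = inv\<^bsub>Gamma\<^esub> (gamma 1) \<otimes>\<^bsub>Gamma\<^esub> wv word_c \<otimes>\<^bsub>Gamma\<^esub> gamma 1"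
    "wv word_c = inv\<^bsub>Gamma\<^esub> (gamma 1) \<otimes>\<^bsub>Gamma\<^esub> wv word_d \<otimes>\<^bsub>Gamma\<^esub> gamma 1"
    "wv word_a = inv\<^bsub>Gamma\<^esub> (gamma 1) \<otimes>\<^bsub>Gamma\<^esub> wv word_b \<otimes>\<^bsub>Gamma\<^esub> gamma 1"
    using g unfolding path_words by (simp_all add: Gamma.m_assoc c)
qed

text \<open>
  The defining relation says that \<open>word_c\<close> and \<open>word_d\<close> commute; the other two commutations are
  conjugates of this one.
\<close>
lemma cd_commute: "wv word_c \<otimes>\<^bsub>Gamma\<^esub> wv word_d = wv word_d \<otimes>\<^bsub>Gamma\<^esub> wv word_c"
proof -
  have "pres_eq gens rels commutator_word []"
    using pres_eq.relation[of "[]" gens "[]" commutator_word "[]" rels] by (simp add: rels_def)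
  then have "pres_rel gens rels `` {commutator_word} = pres_rel gens rels `` {[]}"
    by (intro equiv_class_eq[OF equiv_pres_rel[OF rels_words]]) (simp add: pres_rel_def)
  then have "wv commutator_word = \<one>\<^bsub>Gamma\<^esub>"
    by (simp add: word_val_presented_group[OF rels_words commutator_word_in_words] one_presented_group)
  moreover have "commutator_word = (word_c @ word_d) @ rev (map inv_letter (word_d @ word_c))"
    by (simp add: commutator_word_def path_words)
  ultimately have "wv (word_c @ word_d) \<otimes>\<^bsub>Gamma\<^esub> inv\<^bsub>Gamma\<^esub> (wv (word_d @ word_c)) = \<one>\<^bsub>Gamma\<^esub>"
    using path_words_in_words by (metis Gamma.word_val_append Gamma.word_val_inverse words_simps(3) commutator_word_in_words)
  then have "wv (word_c @ word_d) = wv (word_d @ word_c)"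
    using path_words_in_words by (metis Gamma.inv_closed Gamma.inv_equality Gamma.inv_inv Gamma.word_val_closed words_simps(3))
  then show ?thesis using path_words_in_words by (simp add: Gamma.word_val_append)
qed

interpretation path: commuting_path Gamma gens gamma "wv word_a" "wv word_b" "wv word_c" "wv word_d"
proof (intro commuting_path.intro commuting_path_axioms.intro Gamma.generated_group_axioms
    Gamma.rational_word Gamma.rational_inv_word path_words_in_words cd_commute)
  have t: "gamma 1 \<in> carrier Gamma" by (simp add: Gamma.gen_closed)
  note closed = path_words_in_words[THEN Gamma.word_val_closed]
  show bc: "wv word_b \<otimes>\<^bsub>Gamma\<^esub> wv word_c = wv word_c \<otimes>\<^bsub>Gamma\<^esub> wv word_b"
    using Gamma.conjugate_commutes[OF cd_commute closed(3,4) t] by (simp only: conj_words[symmetric])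
  show "wv word_a \<otimes>\<^bsub>Gamma\<^esub> wv word_b = wv word_b \<otimes>\<^bsub>Gamma\<^esub> wv word_a"
    using Gamma.conjugate_commutes[OF bc closed(2,3) t] by (simp only: conj_words[symmetric])
qed

definition pt :: "nat \<Rightarrow> nat \<Rightarrow> point" where
  "pt m n = (0, of_nat m, of_nat n)"

lemma pt_eq_iff [simp]: "pt m n = pt m' n' \<longleftrightarrow> m = m' \<and> n = n'"
  by (simp add: pt_def)

lemma act_abcd:
  "group_act (wv word_a) (pt m n) = pt (2 * m + 1) n"
  "group_act (wv word_b) (pt m n) = pt m (2 * n)"
  "group_act (wv word_c) (pt m n) = pt (2 * m) n"
  "group_act (wv word_d) (pt m n) = pt m (2 * n + 1)"
  by (simp_all add: group_act_word path_words_in_words) (simp_all add: path_words pt_def)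

lemma act_pow:
  "group_act (wv word_b [^]\<^bsub>Gamma\<^esub> k) (pt m n) = pt m (2 ^ k * n)" for k :: nat
  by (induction k arbitrary: m n) (simp_all add: group_act_one group_act_mult act_abcd mult.assoc)

lemma act_pow_c:
  "group_act (wv word_c [^]\<^bsub>Gamma\<^esub> k) (pt m n) = pt (2 ^ k * m) n" for k :: nat
  by (induction k arbitrary: m n) (simp_all add: group_act_one group_act_mult act_abcd mult.assoc)

text \<open>
  The coordinates of the images of the point \<open>(1, 0)\<close> under \<open>vprod ps\<close>. The first sees only the
  letters \<open>a\<close> and \<open>c\<close>, hence the second components of \<open>ps\<close>; the second sees only \<open>b\<close> and \<open>d\<close>, hence
  the first components.
\<close>
primrec vfst :: "(nat \<times> nat) list \<Rightarrow> nat" where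
  "vfst [] = 1"
| "vfst (p # ps) = 2 * (2 ^ snd p * vfst ps) + 1"

primrec vsnd :: "(nat \<times> nat) list \<Rightarrow> nat" where
  "vsnd [] = 0"
| "vsnd (p # ps) = 2 ^ fst p * (2 * vsnd ps + 1)"

primrec fold_odd :: "nat \<Rightarrow> nat list \<Rightarrow> nat" where
  "fold_odd m [] = m"
| "fold_odd m (n # ns) = 2 ^ n * (2 * fold_odd m ns + 1)"

lemma act_vprod: "group_act (path.vprod ps) (pt 1 0) = pt (vfst ps) (vsnd ps)"
proof (induction ps)
  case Nil
  then show ?case by (simp add: group_act_one)
next
  case (Cons p ps)
  then show ?case by (simp add: group_act_mult act_abcd act_pow act_pow_c)
qed

lemma act_uprod: "group_act (path.uprod ns) (pt m k) = pt (fold_odd m ns) (fold_odd k ns)"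
proof (induction ns)
  case Nil
  then show ?case by (simp add: group_act_one)
next
  case (Cons n ns)
  then show ?case by (simp add: group_act_mult act_abcd act_pow act_pow_c)
qed

lemma pow2_odd_unique:
  "2 ^ m * (2 * x + 1) = 2 ^ n * (2 * y + 1) \<Longrightarrow> m = n \<and> x = y" for m n x y :: nat
proof (induction m arbitrary: n)
  case 0
  have "odd (2 ^ n * (2 * y + 1))" unfolding 0[symmetric] by simp
  then have "n = 0" by (cases n) simp_all
  with 0 show ?case by simp
next
  case (Suc m)
  show ?case
  proof (cases n)
    case 0
    with Suc.prems have "2 ^ Suc m * (2 * x + 1) = 2 * y + 1" by simp
    moreover have "even (2 ^ Suc m * (2 * x + 1))" by simp
    ultimately show ?thesis by simp
  next
    case (Suc n')
    with Suc.prems have "2 ^ m * (2 * x + 1) = 2 ^ n' * (2 * y + 1)" by simp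
    with Suc.IH Suc show ?thesis by blast
  qed
qed

text \<open>
  The second coordinates determine the number of blocks and show that \<open>ns\<close> lists the first
  components of \<open>ps\<close>; here the start value \<open>0\<close> marks the end of a list, since every further block
  gives a positive number. The first coordinates then show that \<open>ns\<close>, followed by \<open>N'\<close>, is \<open>N\<close>
  followed by the second components of \<open>ps\<close>.
\<close>
lemma chain_of_coordinates:
  "2 ^ N * vfst ps = fold_odd (2 ^ N') ns \<Longrightarrow> vsnd ps = fold_odd 0 ns \<Longrightarrow> chain N ps N'"
proof (induction ps arbitrary: N ns)
  case Nil
  then show ?case by (cases ns) auto
next
  case (Cons p ps)
  obtain x y where p: "p = (x, y)" by (cases p)
  from Cons.prems(2) obtain n ns' where ns: "ns = n # ns'" by (cases ns) (auto simp: p)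
  have "x = n" "vsnd ps = fold_odd 0 ns'"
    using pow2_odd_unique[of x "vsnd ps" n "fold_odd 0 ns'"] Cons.prems(2) by (auto simp: p ns)
  moreover have "N = n" "2 ^ y * vfst ps = fold_odd (2 ^ N') ns'"
    using pow2_odd_unique[of N "2 ^ y * vfst ps" n "fold_odd (2 ^ N') ns'"] Cons.prems(1)
    by (auto simp: p ns)
  ultimately show ?case using Cons.IH by (simp add: p)
qed

interpretation path: faithful_commuting_path Gamma gens gamma "wv word_a" "wv word_b" "wv word_c" "wv word_d"
proof (intro faithful_commuting_path.intro faithful_commuting_path_axioms.intro path.commuting_path_axioms)
  fix N N' :: nat and ps ns
  assume "wv word_c [^]\<^bsub>Gamma\<^esub> N \<otimes>\<^bsub>Gamma\<^esub> path.vprod ps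
    = path.uprod ns \<otimes>\<^bsub>Gamma\<^esub> wv word_c [^]\<^bsub>Gamma\<^esub> N'"
  then have "group_act (wv word_c [^]\<^bsub>Gamma\<^esub> N \<otimes>\<^bsub>Gamma\<^esub> path.vprod ps) (pt 1 0)
    = group_act (path.uprod ns \<otimes>\<^bsub>Gamma\<^esub> wv word_c [^]\<^bsub>Gamma\<^esub> N') (pt 1 0)" by simp
  then have "pt (2 ^ N * vfst ps) (vsnd ps) = pt (fold_odd (2 ^ N' * 1) ns) (fold_odd 0 ns)"
    by (simp only: group_act_mult act_vprod act_uprod act_pow_c path.vprod_closed path.uprod_closed
        path.abcd_closed Gamma.nat_pow_closed)
  then show "chain N ps N'"
    by (intro chain_of_coordinates) (simp_all add: mult.commute)
qed

section \<open>Undecidability\<close>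

text \<open>
  Recursive functions that produce the code of the instance for a given automaton. The letter
  \<open>Inl 0\<close> has code \<open>0\<close>, so that a power of the generator \<open>0\<close> is coded by a list of zeros.
\<close>
definition "rf_add = PrimRec (Proj 0) (Comp Succ [Proj 1])"
definition "rf_triangle = PrimRec Zero (Comp rf_add [Comp Succ [Proj 0], Proj 1])"
definition "rf_pow2 = PrimRec (Comp Succ [Zero]) (Comp rf_add [Proj 1, Proj 1])"
definition "rf_pair = Comp rf_add [Comp rf_triangle [rf_add], Proj 0]"
definition "rf_zeros = PrimRec Zero (Comp Succ [Comp rf_triangle [Proj 1]])"

lemma rf_add: "rec_eval rf_add [m, n] z \<longleftrightarrow> z = m + n"
  unfolding rf_add_def by (induction m arbitrary: z) (auto simp: rec_eval_simps list_all2_Cons1)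

lemma rf_triangle: "rec_eval rf_triangle [n] z \<longleftrightarrow> z = triangle n"
  unfolding rf_triangle_def
  by (induction n arbitrary: z) (auto simp: rec_eval_simps list_all2_Cons1 rf_add)

lemma rf_pow2: "rec_eval rf_pow2 [n] z \<longleftrightarrow> z = 2 ^ n"
  unfolding rf_pow2_def
  by (induction n arbitrary: z) (auto simp: rec_eval_simps list_all2_Cons1 rf_add)

lemma rf_pair: "rec_eval rf_pair [m, n] z \<longleftrightarrow> z = prod_encode (m, n)"
  unfolding rf_pair_def
  by (auto simp: rec_eval_simps list_all2_Cons1 rf_add rf_triangle prod_encode_def)

lemma rf_zeros: "rec_eval rf_zeros [n] z \<longleftrightarrow> z = list_encode (replicate n 0)"
  unfolding rf_zeros_def
  by (induction n arbitrary: z)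
    (auto simp: rec_eval_simps list_all2_Cons1 rf_triangle prod_encode_def)

text \<open>
  A diagonal argument in which codes of automata take the place of codes of programs. A decision
  procedure \<open>f\<close> yields a recursive function \<open>F\<close> that, given the code
  \<open>e\<close> of an automaton, decides whether this automaton accepts the input word for \<open>e\<close>. Some
  automaton \<open>M\<close> accepts the input word for \<open>n\<close> exactly if \<open>F\<close> has value \<open>0\<close> at \<open>n\<close>. For the code of
  \<open>M\<close> itself this is contradictory.
\<close>
theorem undecidable_Gamma: "\<not> decidable_rational_subset_membership Gamma gens gamma"
proof
  let ?input = "\<lambda>n. replicate (2 ^ n) (Inl 0) :: nat word"
  let ?P = "rational_subset_membership Gamma gens gamma"
  assume "decidable_rational_subset_membership Gamma gens gamma"
  then obtain f where f: "\<And>n. rec_eval f [n] (if n \<in> encode_instance ` ?P then 1 else 0)"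
    by (auto simp: decidable_rational_subset_membership_def decidable_def)
  define F where "F = Comp f [Comp rf_pair [Proj 0, Comp rf_zeros [rf_pow2]]]"
  have F: "rec_eval F [encode_nfa M] 0 \<longleftrightarrow> (M, ?input (encode_nfa M)) \<notin> ?P" for M
  proof -
    let ?e = "encode_nfa M"
    let ?I = "(M, ?input ?e)"
    have "encode_instance ?I = prod_encode (?e, list_encode (replicate (2 ^ ?e) 0))"
      by (simp add: encode_instance_def encode_word_def sum_encode_def)
    then have "rec_eval F [?e] 0 \<longleftrightarrow> rec_eval f [encode_instance ?I] 0"
      unfolding F_def by (simp add: rec_eval_simps list_all2_Cons1 rf_pair rf_zeros rf_pow2)
    also have "\<dots> \<longleftrightarrow> encode_instance ?I \<notin> encode_instance ` ?P"
      using f[of "encode_instance ?I"]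
        rec_eval_deterministic[of f "[encode_instance ?I]" 0 1] by (auto split: if_splits)
    also have "\<dots> \<longleftrightarrow> ?I \<notin> ?P" by (simp add: inj_image_mem_iff[OF inj_encode_instance])
    finally show ?thesis .
  qed
  obtain R where R: "program R"
    "\<And>n. (\<lambda>r. if r = 0 then n else 0, \<lambda>_. 0) \<in> R \<longleftrightarrow> rec_eval F [n] 0"
    using program_accepts_zeros by blast
  obtain S where S: "Gamma.rational S"
    "\<And>n. wv word_c [^]\<^bsub>Gamma\<^esub> (2 ^ n :: nat) \<in> S \<longleftrightarrow> rec_eval F [n] 0"
    using path.program_rational_subset[OF R(1)] R(2) by blast
  obtain M where M: "nfa_over (gens <+> gens) M" "wv ` nfa_lang M = S"
    using Gamma.rational_nfa[OF S(1)] by blast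
  have "wv (replicate n (Inl 0)) = wv word_c [^]\<^bsub>Gamma\<^esub> n" for n
    by (induction n)
      (simp_all add: path_words Gamma.gen_closed Gamma.nat_pow_Suc2[symmetric] del: Gamma.nat_pow_Suc)
  moreover have "replicate n (Inl 0) \<in> words gens" for n
    by (induction n) auto
  ultimately have "(M, ?input n) \<in> ?P \<longleftrightarrow> rec_eval F [n] 0" for n
    using M S(2) by (simp add: rational_subset_membership_def)
  then show False using F by blast
qed

theorem corollary2p5:
  shows "\<exists>(A :: nat set) (w :: nat word).
    finite A \<and> w \<in> words A \<and>
    \<not> decidable_rational_subset_membership
        (presented_group A {(w, [])}) A (pres_gen A {(w, [])})"
proof (intro exI conjI)
  show "finite gens" by (simp add: gens_def)
  show "commutator_word \<in> words gens" by (rule commutator_word_in_words)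
  show "\<not> decidable_rational_subset_membership (presented_group gens {(commutator_word, [])}) gens
      (pres_gen gens {(commutator_word, [])})"
    using undecidable_Gamma by (simp add: rels_def)
qed

end
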